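(* Let $B$ be an elliptic or doubly parabolic finite Blaschke product of degree $d\ge 2$. Let $\lambda_1,\dots,\lambda_m\in\mathbb{C}$ with $0\le|\lambda_1|<|\lambda_2|<\dots<|\lambda_m|$. Then there is $w\in\mathbb{A}$ such that the operator $T:\mathbb{A}\to\mathbb{A}$, $(Tf)(z)=w(z)f(B(z))$, $f\in\mathbb{A}$, $z\in\mathbb{D}$, satisfies $\sigma_{usf}(T)=\bigcup_{j=1}^m \lambda_j\mathbb{T}$.
   Context: $\mathbb{U}$ is the open unit disc, $\mathbb{D}$ the closed unit disc, $\mathbb{T}=\partial\mathbb{D}$; $\lambda\mathbb{T}=\{\lambda t: t\in\mathbb{T}\}$. The disc algebra $\mathbb{A}$ consists of functions analytic in $\mathbb{U}$ and continuous on $\mathbb{D}$, with the sup norm. A finite Blaschke product of degree $d$ is $B(z)=e^{i\theta}\prod_{j=1}^d \frac{z-a_j}{1-\overline{a_j}z}$, $|a_j|<1$. Its Wolff–Denjoy point $z_0\in\mathbb{D}$ is the unique point such that the iterates of $B$ converge to $z_0$ uniformly on compact subsets of $\mathbb{U}$; $B$ is elliptic if $z_0\in\mathbb{U}$, and doubly parabolic if $z_0\in\mathbb{T}$, $|B'(z_0)|=1$ and $z_0$ is a fixed point of multiplicity 2. For a bounded operator $T$ on a Banach space $X$, $\sigma_{usf}(T)$ (upper semi-Fredholm spectrum) is the set of $\lambda$ for which there exist $x_n\in X$, $\|x_n\|=1$, with $Tx_n-\lambda x_n\to0$ and $(x_n)$ having no norm-convergent subsequence. *)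

theory Defs
  imports "HOL-Complex_Analysis.Complex_Analysis"
begin

definition blaschke :: "real \<Rightarrow> (nat \<Rightarrow> complex) \<Rightarrow> nat \<Rightarrow> complex \<Rightarrow> complex" where
  "blaschke \<theta> a d z = exp (\<i> * of_real \<theta>) * (\<Prod>j<d. (z - a j) / (1 - cnj (a j) * z))"

definition valid_blaschke :: "(nat \<Rightarrow> complex) \<Rightarrow> nat \<Rightarrow> bool" where
  "valid_blaschke a d \<longleftrightarrow> (\<forall>j<d. cmod (a j) < 1)"

definition iterates_converge_to :: "(complex \<Rightarrow> complex) \<Rightarrow> complex \<Rightarrow> bool" where
  "iterates_converge_to B z0 \<longleftrightarrow>
     (\<forall>K. compact K \<and> K \<subseteq> ball 0 1 \<longrightarrow> uniform_limit K (\<lambda>n. B ^^ n) (\<lambda>_. z0) sequentially)"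

definition elliptic :: "(complex \<Rightarrow> complex) \<Rightarrow> bool" where
  "elliptic B \<longleftrightarrow> (\<exists>z0 \<in> ball 0 1. iterates_converge_to B z0)"

definition doubly_parabolic :: "(complex \<Rightarrow> complex) \<Rightarrow> bool" where
  "doubly_parabolic B \<longleftrightarrow> (\<exists>z0 \<in> sphere 0 1. iterates_converge_to B z0
       \<and> cmod (deriv B z0) = 1 \<and> B z0 = z0 \<and> zorder (\<lambda>z. B z - z) z0 = 2)"

text \<open>Disc algebra: continuous on the closed disc, holomorphic on the open disc
  (values outside the closed disc are irrelevant).\<close>
definition disc_alg :: "(complex \<Rightarrow> complex) set" where
  "disc_alg = {f. continuous_on (cball 0 1) f \<and> f holomorphic_on ball 0 1}"

definition supnorm :: "(complex \<Rightarrow> complex) \<Rightarrow> real" where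
  "supnorm f = (SUP z \<in> cball 0 1. cmod (f z))"

text \<open>Upper semi-Fredholm spectrum of T on the disc algebra (sequence characterisation).\<close>
definition usf_spectrum :: "((complex \<Rightarrow> complex) \<Rightarrow> (complex \<Rightarrow> complex)) \<Rightarrow> complex set" where
  "usf_spectrum T = {\<mu>. \<exists>x :: nat \<Rightarrow> complex \<Rightarrow> complex.
      (\<forall>n. x n \<in> disc_alg \<and> supnorm (x n) = 1) \<and>
      (\<lambda>n. supnorm (\<lambda>z. T (x n) z - \<mu> * x n z)) \<longlonglongrightarrow> 0 \<and>
      \<not> (\<exists>r g. strict_mono r \<and> g \<in> disc_alg \<and>
             (\<lambda>n. supnorm (\<lambda>z. x (r n) z - g z)) \<longlonglongrightarrow> 0)}"

end

theory Submission
  imports Defs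
begin

text \<open>
  On the circle \<open>B\<close> lifts to an increasing homeomorphism \<open>b\<close> of the line with
  \<open>b(t + 2\<pi>) = b(t) + 2\<pi>d\<close>. The last \<open>t\<close> with \<open>b(t) \<le> t\<close> gives a
  fixed point \<open>p\<close> towards which every point of the circle has a backward orbit, and the
  intermediate value theorem gives infinitely many periodic points. Choose disjoint periodic orbits
  \<open>O\<^sub>j\<close> for \<open>j < m\<close>, avoiding \<open>p\<close>, and a weight \<open>w\<close> with \<open>|w| \<le> |\<lambda>\<^sub>m| = |w(p)|\<close>, with \<open>|w| = |\<lambda>\<^sub>j|\<close> on \<open>O\<^sub>j\<close>,
  and with zeros at all preimages of \<open>O\<^sub>j\<close> outside \<open>O\<^sub>j\<close> and at no other point of the circle (except
  \<open>O\<^sub>1\<close> if \<open>\<lambda>\<^sub>1 = 0\<close>).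

  If \<open>f\<^sub>n\<close> are approximate eigenvectors for \<open>\<mu>\<close>, the limits \<open>c\<close> of \<open>|f\<^sub>n|\<close> along sequences of points
  converging to \<open>x\<close> are transported along \<open>B\<close> by \<open>|\<mu>| c = |w(x)| c'\<close>. Following an orbit backwards to
  \<open>p\<close>, or around \<open>O\<^sub>j\<close>, they grow beyond \<open>1\<close> unless \<open>|\<mu>|\<close> is one of the \<open>|\<lambda>\<^sub>j|\<close>. Conversely, let \<open>g\<close> peak at a point
  close to \<open>O\<^sub>j\<close> that is not preperiodic; for tent coefficients \<open>c\<^sub>k\<close> the function
  \<open>f = \<Sum>\<^sub>k c\<^sub>k \<mu>\<^sup>-\<^sup>k T\<^sup>k g\<close> telescopes under \<open>T - \<mu>\<close>, and its summands are almost disjointly supported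
  because \<open>w\<close> kills every backward branch that leaves \<open>O\<^sub>j\<close>.
\<close>

subsection \<open>The disc algebra and interpolation of moduli on the circle\<close>

lemma norm_le_supnorm:
  assumes "h \<in> disc_alg" "cmod z \<le> 1"
  shows "cmod (h z) \<le> supnorm h"
proof -
  have "continuous_on (cball 0 1) (\<lambda>z. cmod (h z))"
    using assms(1) by (intro continuous_on_norm) (simp add: disc_alg_def)
  then have "compact ((\<lambda>z. cmod (h z)) ` cball 0 1)"
    by (intro compact_continuous_image) auto
  then have "bdd_above ((\<lambda>z. cmod (h z)) ` cball 0 1)"
    by (simp add: bounded_imp_bdd_above compact_imp_bounded)
  then show ?thesis
    unfolding supnorm_def using assms(2) by (intro cSUP_upper) auto
qed

text \<open>Maximum modulus principle; thanks to it every later norm estimate is made on the circle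
  only.\<close>

lemma supnorm_le:
  assumes h: "h \<in> disc_alg" and M: "\<And>z. cmod z = 1 \<Longrightarrow> cmod (h z) \<le> M"
  shows "supnorm h \<le> M"
  unfolding supnorm_def
proof (rule cSUP_least)
  fix z :: complex assume z: "z \<in> cball 0 1"
  show "cmod (h z) \<le> M"
  proof (rule maximum_modulus_frontier[where S = "cball 0 1" and f = h])
    show "h holomorphic_on interior (cball 0 1)" "continuous_on (closure (cball 0 1)) h"
      using h by (simp_all add: disc_alg_def)
    show "cmod (h z) \<le> M" if "z \<in> frontier (cball 0 1)" for z
      using that M by (simp add: frontier_cball)
  qed (use z in auto)
qed auto

lemma supnorm_attained:
  assumes h: "h \<in> disc_alg"
  obtains z where "cmod z = 1" "cmod (h z) = supnorm h"
proof -
  have "continuous_on (sphere 0 1) (\<lambda>z. cmod (h z))"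
    using h continuous_on_subset[of "cball 0 1" h "sphere 0 1"]
    by (intro continuous_on_norm) (auto simp: disc_alg_def)
  then obtain z where z: "z \<in> sphere 0 1" "\<And>y. y \<in> sphere 0 1 \<Longrightarrow> cmod (h y) \<le> cmod (h z)"
    using continuous_attains_sup[of "sphere (0::complex) 1" "\<lambda>z. cmod (h z)"] by fastforce
  have "supnorm h \<le> cmod (h z)"
    using z by (intro supnorm_le[OF h]) auto
  with norm_le_supnorm[OF h, of z] z that show thesis by fastforce
qed

lemma supnorm_nonneg: "h \<in> disc_alg \<Longrightarrow> 0 \<le> supnorm h"
  using norm_le_supnorm[of h 0] norm_ge_zero[of "h 0"] by (metis norm_zero order_trans zero_le_one)

lemma supnorm_cmult:
  assumes h: "h \<in> disc_alg"
  shows "supnorm (\<lambda>z. c * h z) = cmod c * supnorm h"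
proof (rule antisym)
  have ch: "(\<lambda>z. c * h z) \<in> disc_alg"
    using h by (simp add: disc_alg_def continuous_on_mult_left holomorphic_on_mult)
  show "supnorm (\<lambda>z. c * h z) \<le> cmod c * supnorm h"
    by (intro supnorm_le[OF ch]) (auto simp: norm_mult intro!: mult_left_mono norm_le_supnorm[OF h])
  obtain z where "cmod z = 1" "cmod (h z) = supnorm h"
    using supnorm_attained[OF h] .
  then show "cmod c * supnorm h \<le> supnorm (\<lambda>z. c * h z)"
    using norm_le_supnorm[OF ch, of z] by (simp add: norm_mult)
qed

lemma disc_alg_intros:
  "(\<lambda>z. c) \<in> disc_alg"
  "f \<in> disc_alg \<Longrightarrow> g \<in> disc_alg \<Longrightarrow> (\<lambda>z. f z + g z) \<in> disc_alg"
  "f \<in> disc_alg \<Longrightarrow> g \<in> disc_alg \<Longrightarrow> (\<lambda>z. f z - g z) \<in> disc_alg"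
  "f \<in> disc_alg \<Longrightarrow> g \<in> disc_alg \<Longrightarrow> (\<lambda>z. f z * g z) \<in> disc_alg"
  "(\<And>i. i \<in> I \<Longrightarrow> F i \<in> disc_alg) \<Longrightarrow> (\<lambda>z. \<Sum>i\<in>I. F i z) \<in> disc_alg"
  "(\<And>i. i \<in> I \<Longrightarrow> F i \<in> disc_alg) \<Longrightarrow> (\<lambda>z. \<Prod>i\<in>I. F i z) \<in> disc_alg"
  by (auto simp: disc_alg_def intro: continuous_on_add continuous_on_diff continuous_on_mult
      continuous_on_sum continuous_on_prod holomorphic_on_add holomorphic_on_diff
      holomorphic_on_mult holomorphic_on_sum holomorphic_on_prod)

section \<open>Peak functions at points of the circle\<close>

lemma peak_power_disc_alg: "(\<lambda>z. ((1 + cnj q * z) / 2) ^ n) \<in> disc_alg"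
  by (auto simp: disc_alg_def intro!: continuous_intros holomorphic_intros)

text \<open>Parallelogram law for the unit vectors \<open>1\<close> and \<open>cnj q * z\<close>,
  whose difference has modulus \<open>cmod (z - q)\<close>.\<close>

lemma peak_norm_square:
  assumes "cmod z = 1" "cmod q = 1"
  shows "(cmod ((1 + cnj q * z) / 2))\<^sup>2 = 1 - (cmod (z - q))\<^sup>2 / 4"
proof -
  have z: "(Re z)\<^sup>2 + (Im z)\<^sup>2 = 1" and q: "(Re q)\<^sup>2 + (Im q)\<^sup>2 = 1"
    using assms by (simp_all add: cmod_def)
  have "(cmod (1 + cnj q * z))\<^sup>2 + (cmod (z - q))\<^sup>2
      = 1 + ((Re z)\<^sup>2 + (Im z)\<^sup>2) * ((Re q)\<^sup>2 + (Im q)\<^sup>2) + ((Re z)\<^sup>2 + (Im z)\<^sup>2) + ((Re q)\<^sup>2 + (Im q)\<^sup>2)"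
    unfolding cmod_power2 by simp algebra
  also have "\<dots> = 4" by (simp add: z q)
  finally show ?thesis
    by (simp add: norm_divide power_divide field_simps)
qed

lemma peak_norm_le:
  assumes "cmod z = 1" "cmod q = 1"
  shows "cmod (((1 + cnj q * z) / 2) ^ n) \<le> 1"
proof -
  have "(cmod ((1 + cnj q * z) / 2))\<^sup>2 \<le> 1\<^sup>2"
    using peak_norm_square[OF assms] by simp
  then have "cmod ((1 + cnj q * z) / 2) \<le> 1"
    by (rule power2_le_imp_le) simp
  then show ?thesis unfolding norm_power by (intro power_le_one) auto
qed

lemma peak_power_small:
  assumes "0 < r" "0 < e"
  shows "\<forall>\<^sub>F n in sequentially. \<forall>q z. cmod z = 1 \<and> cmod q = 1 \<and> r \<le> cmod (z - q)
           \<longrightarrow> cmod (((1 + cnj q * z) / 2) ^ n) \<le> e"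
proof -
  \<comment> \<open>\<open>s\<close> bounds the base at distance \<open>r\<close> or more from the
    peak; the \<open>max\<close> covers \<open>r > 2\<close>, where the circle has no such
    points.\<close>
  define s where "s = sqrt (max 0 (1 - r\<^sup>2 / 4))"
  have s: "0 \<le> s" "s < 1" using assms by (auto simp: s_def)
  have "(\<lambda>n. s ^ n) \<longlonglongrightarrow> 0" using s by (intro LIMSEQ_power_zero) auto
  then have "\<forall>\<^sub>F n in sequentially. s ^ n < e"
    using assms(2) by (rule order_tendstoD)
  then show ?thesis
  proof eventually_elim
    case (elim n)
    show ?case
    proof (intro allI impI)
      fix q z :: complex assume a: "cmod z = 1 \<and> cmod q = 1 \<and> r \<le> cmod (z - q)"
      then have "(cmod ((1 + cnj q * z) / 2))\<^sup>2 = 1 - (cmod (z - q))\<^sup>2 / 4"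
        by (intro peak_norm_square) auto
      moreover have "r\<^sup>2 \<le> (cmod (z - q))\<^sup>2" using a assms by (intro power_mono) auto
      ultimately have "(cmod ((1 + cnj q * z) / 2))\<^sup>2 \<le> s\<^sup>2"
        unfolding s_def by (subst real_sqrt_pow2) auto
      then have "cmod ((1 + cnj q * z) / 2) \<le> s" using s(1) by (rule power2_le_imp_le)
      then have "cmod (((1 + cnj q * z) / 2) ^ n) \<le> s ^ n"
        unfolding norm_power by (intro power_mono) auto
      with elim show "cmod (((1 + cnj q * z) / 2) ^ n) \<le> e" by simp
    qed
  qed
qed

section \<open>Prescribing moduli at finitely many points of the circle\<close>

lemma poly_norm_square_eq_Re:
  "\<exists>G :: complex poly. \<forall>z. cmod z = 1 \<longrightarrow> Re (poly G z) = (cmod (poly P z))\<^sup>2"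
proof (induction P)
  case 0
  show ?case by (intro exI[of _ 0]) auto
next
  case (pCons c P)
  then obtain G where G: "\<And>z. cmod z = 1 \<Longrightarrow> Re (poly G z) = (cmod (poly P z))\<^sup>2" by auto
  \<comment> \<open>On the circle |c + zP|^2 = |c|^2 + |P|^2 + 2 Re(cnj c * zP). The first and the
    last term are real parts of polynomials, and so is the middle one by induction.\<close>
  have "Re (poly (pCons (of_real ((cmod c)\<^sup>2)) (smult (2 * cnj c) P) + G) z) = (cmod (poly (pCons c P) z))\<^sup>2"
    if z: "cmod z = 1" for z
  proof -
    have "(cmod (c + z * poly P z))\<^sup>2 = (cmod c)\<^sup>2 + (cmod (z * poly P z))\<^sup>2 + 2 * Re (cnj c * (z * poly P z))"
      by (simp add: cmod_power2) (simp add: power2_eq_square algebra_simps)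
    then show ?thesis using G[OF z] z by (simp add: norm_mult algebra_simps)
  qed
  then show ?case by blast
qed

text \<open>With \<open>s(z) = (p + z) / (p - z)\<close>, which maps the disc to the right half-plane and \<open>p\<close> to infinity,
  the factor is \<open>(s(z) - s(x)) / (s(z) - s(x) + 2\<delta>)\<close>.\<close>

definition horo_factor :: "complex \<Rightarrow> real \<Rightarrow> complex \<Rightarrow> complex \<Rightarrow> complex" where
  "horo_factor p \<delta> x z = (z - x) / ((z - x) + of_real \<delta> * cnj p * (p - z) * (p - x))"

text \<open>As \<open>x\<close> lies on the circle, s(x) is imaginary, while Re s(z) \<ge> 0; hence
  adding 2\<delta> to s(z) - s(x) cannot decrease its modulus. Clearing denominators extends the
  argument to z = p.\<close>

lemma horo_factor:
  assumes p: "cmod p = 1" and x: "cmod x = 1" "x \<noteq> p" and \<delta>: "\<delta> > 0" and z: "cmod z \<le> 1"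
  shows "(z - x) + of_real \<delta> * cnj p * (p - z) * (p - x) \<noteq> 0"
    and "cmod (horo_factor p \<delta> x z) \<le> 1"
proof -
  define X where "X = of_real \<delta> * cnj p * (p - z) * (p - x)"
  have p1: "(Re p)\<^sup>2 + (Im p)\<^sup>2 = 1" and x1: "(Re x)\<^sup>2 + (Im x)\<^sup>2 = 1"
    using p x by (simp_all add: cmod_def)
  have z1: "(Re z)\<^sup>2 + (Im z)\<^sup>2 \<le> 1"
    using power_mono[OF z norm_ge_zero, of 2] by (simp add: cmod_power2)
  \<comment> \<open>An identity for arbitrary \<open>p\<close>, \<open>x\<close> and
    \<open>z\<close>; that \<open>p\<close> and \<open>x\<close> lie on the circle enters only in
    the simplification that follows it.\<close>
  have "2 * Re ((z - x) * cnj (cnj p * (p - z) * (p - x)))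
     = ((Re p)\<^sup>2 + (Im p)\<^sup>2 - (Re z)\<^sup>2 - (Im z)\<^sup>2) * (cmod (p - x))\<^sup>2
       - ((Re p)\<^sup>2 + (Im p)\<^sup>2 - (Re x)\<^sup>2 - (Im x)\<^sup>2) * (cmod (p - z))\<^sup>2"
    by (simp add: cmod_power2) algebra
  also have "\<dots> = (1 - ((Re z)\<^sup>2 + (Im z)\<^sup>2)) * (cmod (p - x))\<^sup>2"
    using p1 x1 by (simp add: algebra_simps)
  also have "\<dots> \<ge> 0" using z1 by simp
  finally have "0 \<le> \<delta> * Re ((z - x) * cnj (cnj p * (p - z) * (p - x)))"
    using \<delta> by simp
  also have "\<dots> = Re ((z - x) * cnj X)"
    by (simp add: X_def algebra_simps)
  finally have pos: "0 \<le> Re ((z - x) * cnj X)" .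
  have eq: "(cmod ((z - x) + X))\<^sup>2 = (cmod (z - x))\<^sup>2 + (cmod X)\<^sup>2 + 2 * Re ((z - x) * cnj X)"
    by (simp add: cmod_power2) (simp add: power2_eq_square algebra_simps)
  have ne: "(z - x) + X \<noteq> 0"
  proof
    assume "(z - x) + X = 0"
    with eq pos have "(cmod (z - x))\<^sup>2 + (cmod X)\<^sup>2 \<le> 0" by simp
    then have "z = x" "X = 0"
      by (smt (verit) norm_eq_zero right_minus_eq zero_le_power2 zero_eq_power2)+
    with x p \<delta> show False unfolding X_def by auto
  qed
  then show "(z - x) + of_real \<delta> * cnj p * (p - z) * (p - x) \<noteq> 0" by (simp add: X_def)
  have "(cmod (z - x))\<^sup>2 \<le> (cmod ((z - x) + X))\<^sup>2" using eq pos by simp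
  then have "cmod (z - x) \<le> cmod ((z - x) + X)" by (rule power2_le_imp_le) simp
  then show "cmod (horo_factor p \<delta> x z) \<le> 1"
    unfolding horo_factor_def X_def[symmetric] using ne by (simp add: norm_divide)
qed

lemma horo_factor_disc_alg:
  assumes "cmod p = 1" "cmod x = 1" "x \<noteq> p" "\<delta> > 0"
  shows "horo_factor p \<delta> x \<in> disc_alg"
  using horo_factor(1)[OF assms]
  by (auto simp: disc_alg_def horo_factor_def[abs_def] intro!: continuous_intros holomorphic_intros)

text \<open>A small \<delta> makes the zero at \<open>x\<close> almost invisible at any other given
  point.\<close>

lemma horo_factor_tendsto:
  assumes "z \<noteq> x"
  shows "((\<lambda>\<delta>. horo_factor p \<delta> x z) \<longlongrightarrow> 1) (at_right 0)"
proof -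
  have "((\<lambda>\<delta>. horo_factor p \<delta> x z) \<longlongrightarrow> (z - x) / ((z - x) + of_real 0 * cnj p * (p - z) * (p - x))) (at_right 0)"
    unfolding horo_factor_def using assms by (intro tendsto_intros) auto
  then show ?thesis using assms by simp
qed

text \<open>Factors \<open>horo_factor\<close> make the zeros, with \<delta> so small that the
  moduli at the remaining points stay above their targets. A zero-free factor
  \<open>exp (- g z)\<close> with Re g \<ge> 0 on the circle then lowers these moduli to the
  targets, independently of each other and leaving \<open>p\<close> alone.\<close>

lemma finite_modulus_interpolation:
  fixes v :: "complex \<Rightarrow> real"
  assumes p: "cmod p = 1" and E: "finite E" "E \<subseteq> sphere 0 1" "p \<notin> E"
    and v: "\<And>q. q \<in> E \<Longrightarrow> 0 \<le> v q \<and> v q < 1"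
  shows "\<exists>w\<in>disc_alg. (\<forall>z. cmod z = 1 \<longrightarrow> cmod (w z) \<le> 1) \<and> cmod (w p) = 1
    \<and> (\<forall>q\<in>E. cmod (w q) = v q) \<and> (\<forall>z. cmod z = 1 \<longrightarrow> w z = 0 \<longrightarrow> z \<in> E)"
proof -
  define Z where "Z = {q\<in>E. v q = 0}"
  define Q where "Q = {q\<in>E. v q > 0}"
  have fin: "finite Z" "finite Q" using E by (auto simp: Z_def Q_def)
  have "\<forall>\<^sub>F \<delta> in at_right 0. v q < cmod (\<Prod>x\<in>Z. horo_factor p \<delta> x q)" if "q \<in> Q" for q
  proof -
    have "((\<lambda>\<delta>. \<Prod>x\<in>Z. horo_factor p \<delta> x q) \<longlongrightarrow> (\<Prod>x\<in>Z. 1)) (at_right 0)"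
      using that by (intro tendsto_prod horo_factor_tendsto) (auto simp: Z_def Q_def)
    then have "((\<lambda>\<delta>. cmod (\<Prod>x\<in>Z. horo_factor p \<delta> x q)) \<longlongrightarrow> 1) (at_right 0)"
      using tendsto_norm by fastforce
    then show ?thesis using v that by (intro order_tendstoD) (auto simp: Q_def)
  qed
  then have "\<forall>\<^sub>F \<delta> in at_right 0. \<forall>q\<in>Q. v q < cmod (\<Prod>x\<in>Z. horo_factor p \<delta> x q)"
    using fin by (simp add: eventually_ball_finite)
  then have "\<forall>\<^sub>F \<delta> in at_right 0. \<delta> > 0 \<and> (\<forall>q\<in>Q. v q < cmod (\<Prod>x\<in>Z. horo_factor p \<delta> x q))"
    by (intro eventually_conj) (auto simp: eventually_at_right_less)
  then obtain \<delta> :: real where \<delta>: "\<delta> > 0" "\<And>q. q \<in> Q \<Longrightarrow> v q < cmod (\<Prod>x\<in>Z. horo_factor p \<delta> x q)"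
    using eventually_happens'[OF trivial_limit_at_right_real] by blast
  define u where "u z = (\<Prod>x\<in>Z. horo_factor p \<delta> x z)" for z
  have Zx: "cmod x = 1" "x \<noteq> p" if "x \<in> Z" for x using that E by (auto simp: Z_def)
  \<comment> \<open>\<open>P q\<close> vanishes at \<open>p\<close> and on \<open>Q - {q}\<close>,
    so |P q|^2, realised as the real part of the analytic \<open>G q\<close>, adjusts the modulus at
    \<open>q\<close> without touching the others.\<close>
  define P where "P q = [:-p, 1:] * (\<Prod>x\<in>Q - {q}. [:-x, 1:])" for q
  obtain G where G: "\<And>q z. cmod z = 1 \<Longrightarrow> Re (poly (G q) z) = (cmod (poly (P q) z))\<^sup>2"
    using choice[OF allI[OF poly_norm_square_eq_Re]] by metis
  have Pp: "poly (P q) p = 0" for q by (simp add: P_def)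
  have Pq: "poly (P q) q \<noteq> 0" if "q \<in> Q" for q
    using that E fin by (auto simp: P_def poly_prod Q_def)
  have Pq': "poly (P q) q' = 0" if "q' \<in> Q" "q \<noteq> q'" for q q'
    using that fin by (auto simp: P_def poly_prod)
  \<comment> \<open>Solves exp(- l q * |P q (q)|^2) * |u q| = v q; it is nonnegative on
    \<open>Q\<close> because \<open>v q < cmod (u q)\<close> there.\<close>
  define l where "l q = ln (cmod (u q) / v q) / (cmod (poly (P q) q))\<^sup>2" for q
  have l: "l q \<ge> 0" if "q \<in> Q" for q
    unfolding l_def using that \<delta>(2)[OF that] by (intro divide_nonneg_nonneg ln_ge_zero) (auto simp: u_def Q_def field_simps)
  define g where "g z = (\<Sum>q\<in>Q. of_real (l q) * poly (G q) z)" for z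
  define w where "w z = u z * exp (- g z)" for z
  have Reg: "Re (g z) = (\<Sum>q\<in>Q. l q * (cmod (poly (P q) z))\<^sup>2)" if "cmod z = 1" for z
    using G that by (simp add: g_def)
  have wnorm: "cmod (w z) = cmod (u z) * exp (- Re (g z))" for z
    by (simp add: w_def norm_mult)
  show ?thesis
  proof (intro bexI[of _ w] conjI allI ballI impI)
    fix z :: complex assume z: "cmod z = 1"
    have "cmod (u z) \<le> 1" unfolding u_def prod_norm[symmetric]
      using horo_factor(2)[OF p Zx \<delta>(1)] z by (intro prod_le_1) auto
    moreover have "Re (g z) \<ge> 0" unfolding Reg[OF z] using l by (intro sum_nonneg) auto
    ultimately show "cmod (w z) \<le> 1" unfolding wnorm by (intro mult_le_one) auto
  next
    have "p \<notin> Z" using Zx by blast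
    \<comment> \<open>The \<delta>-term of each factor contains \<open>p - z\<close> and vanishes at
      \<open>z = p\<close>.\<close>
    then have "u p = 1" by (auto simp: u_def horo_factor_def intro!: prod.neutral)
    moreover have "Re (g p) = 0" using Reg[OF p] Pp by simp
    ultimately show "cmod (w p) = 1" by (simp add: wnorm)
  next
    fix q assume q: "q \<in> E"
    then have q1: "cmod q = 1" using E by auto
    show "cmod (w q) = v q"
    proof (cases "q \<in> Z")
      case True
      then have "u q = 0" using fin by (auto simp: u_def horo_factor_def)
      then show ?thesis using True by (simp add: wnorm Z_def)
    next
      case False
      then have qQ: "q \<in> Q" using q v[OF q] by (auto simp: Z_def Q_def)
      have "Re (g q) = (\<Sum>x\<in>{q}. l x * (cmod (poly (P x) q))\<^sup>2)"
        unfolding Reg[OF q1] using qQ fin Pq' by (intro sum.mono_neutral_right) auto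
      also have "\<dots> = ln (cmod (u q) / v q)" using Pq[OF qQ] by (simp add: l_def)
      finally have "Re (g q) = ln (cmod (u q) / v q)" .
      moreover have "v q > 0" "cmod (u q) > 0"
        using qQ \<delta>(2)[OF qQ] by (auto simp: u_def Q_def)
      ultimately show ?thesis
        by (simp add: wnorm exp_minus exp_ln divide_pos_pos)
    qed
  next
    fix z :: complex assume z: "cmod z = 1" "w z = 0"
    then obtain x where "x \<in> Z" "horo_factor p \<delta> x z = 0" using fin by (auto simp: w_def u_def)
    then show "z \<in> E" using horo_factor(1)[OF p Zx \<delta>(1), of x z] z by (auto simp: horo_factor_def Z_def)
  next
    have "u \<in> disc_alg" unfolding u_def[abs_def] using horo_factor_disc_alg[OF p] Zx \<delta> by (auto intro!: disc_alg_intros)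
    moreover have "(\<lambda>z. exp (- g z)) \<in> disc_alg"
      unfolding disc_alg_def g_def by (auto intro!: continuous_intros holomorphic_intros)
    ultimately show "w \<in> disc_alg" unfolding w_def[abs_def] by (rule disc_alg_intros)
  qed
qed

text \<open>The part of the circle where \<open>W\<close> is at least \<open>M\<close> is compact
  and its image under \<open>h\<close> misses \<open>q\<close>, hence keeps a positive distance from
  \<open>q\<close>. A strict bound on one fibre thus spreads to the preimage of a
  neighbourhood.\<close>

lemma eventually_near_fibre:
  fixes h :: "complex \<Rightarrow> complex" and W :: "complex \<Rightarrow> real"
  assumes h: "continuous_on (sphere 0 1) h" and W: "continuous_on (sphere 0 1) W"
    and M: "\<And>y. cmod y = 1 \<Longrightarrow> h y = q \<Longrightarrow> W y < M"
  shows "\<forall>\<^sub>F r in at_right 0. \<forall>y. cmod y = 1 \<and> dist (h y) q < r \<longrightarrow> W y < M"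
proof -
  define K where "K = sphere 0 1 \<inter> W -` {M..}"
  have "closed K"
    unfolding K_def using W by (intro continuous_closed_preimage) auto
  then have "compact K"
    unfolding K_def using compact_eq_bounded_closed bounded_subset[OF bounded_sphere[of 0 1]] by blast
  then have "compact (h ` K)"
    using h by (intro compact_continuous_image) (auto intro: continuous_on_subset simp: K_def)
  moreover have "q \<notin> h ` K" using M by (force simp: K_def)
  ultimately obtain r where r: "r > 0" "\<And>x. x \<in> h ` K \<Longrightarrow> r \<le> dist q x"
    using separate_point_closed compact_imp_closed by metis
  have "\<forall>y. cmod y = 1 \<and> dist (h y) q < r' \<longrightarrow> W y < M" if "r' < r" for r'
  proof (intro allI impI, rule ccontr)
    fix y assume y: "cmod y = 1 \<and> dist (h y) q < r'" "\<not> W y < M"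
    then have "r \<le> dist q (h y)" by (intro r) (auto simp: K_def)
    with y that show False by (simp add: dist_commute)
  qed
  then show ?thesis unfolding eventually_at_right_field using r(1) by blast
qed

lemma eventually_at_right_le: "0 < c \<Longrightarrow> \<forall>\<^sub>F r in at_right 0. r \<le> (c::real)"
  unfolding eventually_at_right_field by (intro exI[of _ c]) auto

lemma supnorm_limit_pointwise:
  assumes "\<And>n. x n \<in> disc_alg" "g \<in> disc_alg" "cmod z \<le> 1"
    and "(\<lambda>n. supnorm (\<lambda>z. x n z - g z)) \<longlonglongrightarrow> 0"
  shows "(\<lambda>n. x n z) \<longlonglongrightarrow> g z"
proof -
  have "cmod (x n z - g z) \<le> supnorm (\<lambda>z. x n z - g z)" for n
    using assms by (intro norm_le_supnorm[where h = "\<lambda>z. x n z - g z"] disc_alg_intros) auto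
  then have "(\<lambda>n. x n z - g z) \<longlonglongrightarrow> 0"
    using Lim_null_comparison[OF _ assms(4), of "\<lambda>n. x n z - g z"] by simp
  then show ?thesis by (simp add: LIM_zero_iff)
qed

lemma circle_image: "(\<lambda>t. c * t) ` sphere 0 1 = {\<mu>. cmod \<mu> = cmod c}"
proof (cases "c = 0")
  case True
  moreover have "\<exists>t. cmod t = 1" by (rule exI[of _ 1]) simp
  ultimately show ?thesis by (auto simp: image_iff)
next
  case False
  have "\<mu> \<in> (\<lambda>t. c * t) ` sphere 0 1" if "cmod \<mu> = cmod c" for \<mu>
    using False that by (intro image_eqI[of _ _ "\<mu> / c"]) (auto simp: norm_divide)
  then show ?thesis by (auto simp: norm_mult)
qed

subsection \<open>Dynamics of circle coverings\<close>

lemma unit_circle_cis: "cmod z = 1 \<Longrightarrow> \<exists>t. z = cis t"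
  using rcis_cmod_Arg[of z] by (intro exI[of _ "Arg z"]) (simp add: rcis_def)

lemma cis_eq_imp_eq:
  assumes "cis s = cis t" "\<bar>s - t\<bar> < 2 * pi"
  shows "s = t"
proof -
  have "cis (s - t) = 1" using assms(1) by (simp add: cis_divide[symmetric])
  then have "cos (s - t) = 1" by (simp add: complex_eq_iff)
  then obtain n :: int where n: "s - t = of_int n * 2 * pi" by (auto simp: cos_one_2pi_int)
  with assms(2) have "\<bar>of_int n\<bar> * (2 * pi) < 1 * (2 * pi)" by (simp add: abs_mult)
  then have "\<bar>real_of_int n\<bar> < 1" by (rule mult_right_less_imp_less) simp
  then have "n = 0" by linarith
  with n show ?thesis by simp
qed

text \<open>By the intermediate value theorem \<open>F\<close> reaches \<open>F 0 + pi\<close>,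
  where \<open>cis\<close> has changed sign. It will show that certain polynomials obtained from
  iterates do not vanish identically.\<close>

lemma cis_comp_not_constant:
  fixes F :: "real \<Rightarrow> real"
  assumes F: "continuous_on UNIV F" "F 0 + pi \<le> F (2 * pi)"
  shows "\<exists>t. cis (F t) \<noteq> cis (F 0)"
proof -
  obtain t where "F t = F 0 + pi"
    using IVT'[of F 0 "F 0 + pi" "2 * pi"] F continuous_on_subset by (metis less_add_same_cancel1 less_imp_le pi_gt_zero subset_UNIV pi_ge_zero mult_nonneg_nonneg zero_le_numeral)
  moreover have "cis (F 0 + pi) = - cis (F 0)" by (simp add: complex_eq_iff)
  moreover have "- cis (F 0) \<noteq> cis (F 0)"
    using cis_neq_zero[of "F 0"] by simp
  ultimately show ?thesis by metis
qed

text \<open>An arc is uncountable; this will give points near a periodic point that are not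
  preperiodic.\<close>

lemma uncountable_arc:
  assumes q: "cmod q = 1" and \<delta>: "\<delta> > 0" and C: "countable C"
  obtains s where "cmod s = 1" "dist s q < \<delta>" "s \<notin> C"
proof -
  obtain t where t: "q = cis t" using unit_circle_cis[OF q] by blast
  have "continuous_on UNIV cis" by (intro continuous_intros)
  then have "isCont cis t" by (simp add: continuous_on_eq_continuous_at)
  then obtain e where e: "e > 0" "\<And>u. dist u t < e \<Longrightarrow> dist (cis u) (cis t) < \<delta>"
    using \<delta> unfolding continuous_at_eps_delta by metis
  define e' where "e' = min e 1"
  have "inj_on cis {t<..<t + e'}"
    using pi_ge_two by (intro inj_onI cis_eq_imp_eq) (auto simp: e'_def)
  moreover have "uncountable {t<..<t + e'}" using e by (intro uncountable_open_interval[THEN iffD2]) (simp add: e'_def)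
  ultimately have "uncountable (cis ` {t<..<t + e'})" using countable_image_inj_on by blast
  then have "\<not> cis ` {t<..<t + e'} \<subseteq> C" using C countable_subset by blast
  then obtain u where "u \<in> {t<..<t + e'}" "cis u \<notin> C" by blast
  moreover from this have "dist (cis u) q < \<delta>" unfolding t by (intro e) (auto simp: e'_def dist_real_def)
  ultimately show thesis using that[of "cis u"] by simp
qed

text \<open>\<open>b\<close> is the lift of \<open>B\<close> to angles and \<open>d\<close> the
  degree on the circle. The rational form of the iterates makes their coincidence sets and the
  fibres of \<open>B\<close> finite.\<close>

locale circle_covering =
  fixes B :: "complex \<Rightarrow> complex" and b :: "real \<Rightarrow> real" and d :: nat
  assumes degree: "d \<ge> 2"
    and B_disc_alg: "B \<in> disc_alg"
    and B_ball: "B ` ball 0 1 \<subseteq> ball 0 1"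
    and B_cis: "B (cis t) = cis (b t)"
    and b_cont: "continuous_on UNIV b"
    and b_mono: "strict_mono b"
    and b_period: "b (t + 2 * pi) = b t + 2 * pi * d"
    and B_rational: "\<exists>P Q. \<forall>z. cmod z = 1 \<longrightarrow> poly Q z \<noteq> 0 \<and> (B ^^ k) z = poly P z / poly Q z"
begin

section \<open>Iterates of the covering and of its lift\<close>

lemma B_sphere: "cmod z = 1 \<Longrightarrow> cmod (B z) = 1"
  using unit_circle_cis B_cis by fastforce

lemma iter_sphere: "cmod z = 1 \<Longrightarrow> cmod ((B ^^ k) z) = 1"
  by (induction k) (auto simp: B_sphere)

lemma B_cball: "cmod z \<le> 1 \<Longrightarrow> cmod (B z) \<le> 1"
  using B_ball B_sphere[of z] by (cases "cmod z = 1") (auto simp: image_subset_iff less_le)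

lemma iter_cis: "(B ^^ k) (cis t) = cis ((b ^^ k) t)"
  by (induction k) (auto simp: B_cis)

lemma b_period_nat: "b (t + 2 * pi * real n) = b t + 2 * pi * d * n"
proof (induction n)
  case (Suc n)
  have "b (t + 2 * pi * real (Suc n)) = b ((t + 2 * pi * real n) + 2 * pi)" by (simp add: algebra_simps)
  then show ?case by (simp add: b_period Suc) (simp add: algebra_simps)
qed simp

lemma iter_b_period: "(b ^^ k) (t + 2 * pi) = (b ^^ k) t + 2 * pi * d ^ k"
proof (induction k)
  case (Suc k)
  have "(b ^^ Suc k) (t + 2 * pi) = b ((b ^^ k) t + 2 * pi * real (d ^ k))" by (simp add: Suc)
  also have "\<dots> = b ((b ^^ k) t) + 2 * pi * d * real (d ^ k)" by (rule b_period_nat)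
  finally show ?case by simp
qed simp

lemma iter_b_cont: "continuous_on UNIV (b ^^ k)"
proof (induction k)
  case (Suc k)
  then show ?case using b_cont by (auto simp: o_def intro!: continuous_on_compose2[OF b_cont])
qed (simp add: id_def)

lemma B_cont: "continuous_on (sphere 0 1) B"
  using B_disc_alg continuous_on_subset[of "cball 0 1" B "sphere 0 1"] by (auto simp: disc_alg_def)

lemma iter_cont: "continuous_on (sphere 0 1) (B ^^ k)"
proof (induction k)
  case (Suc k)
  then show ?case
    using iter_sphere by (auto simp: o_def intro!: continuous_on_compose2[OF B_cont])
qed (simp add: id_def)

text \<open>Clearing denominators leaves a polynomial. If it were zero, the difference of the two
  lifts would be 0 modulo 2 pi everywhere, although it is continuous and grows by 2 pi (d^k - d^i)
  \<ge> 2 pi over one period.\<close>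

lemma finite_coincidence:
  assumes "i < k"
  shows "finite {z. cmod z = 1 \<and> (B ^^ i) z = (B ^^ k) z}"
proof -
  obtain P Q where PQ: "\<And>z. cmod z = 1 \<Longrightarrow> poly Q z \<noteq> 0 \<and> (B ^^ i) z = poly P z / poly Q z"
    using B_rational by meson
  obtain P' Q' where PQ': "\<And>z. cmod z = 1 \<Longrightarrow> poly Q' z \<noteq> 0 \<and> (B ^^ k) z = poly P' z / poly Q' z"
    using B_rational by meson
  have eq: "(B ^^ i) z = (B ^^ k) z \<longleftrightarrow> poly (P * Q' - P' * Q) z = 0" if "cmod z = 1" for z
    using PQ[OF that] PQ'[OF that] by (auto simp: field_simps)
  have "P * Q' - P' * Q \<noteq> 0"
  proof
    assume "P * Q' - P' * Q = 0"
    then have "(B ^^ i) (cis t) = (B ^^ k) (cis t)" for t using eq[of "cis t"] by simp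
    then have *: "cis ((b ^^ k) t - (b ^^ i) t) = 1" for t
      by (simp add: iter_cis cis_divide[symmetric])
    have "d ^ i < d ^ k" using assms degree by (intro power_strict_increasing) auto
    then have "real (d ^ i) + 1 \<le> real (d ^ k)" by linarith
    then have "2 * pi * (real (d ^ i) + 1) \<le> 2 * pi * real (d ^ k)" by (intro mult_left_mono) auto
    moreover have "2 * pi * (real (d ^ i) + 1) = 2 * pi * real (d ^ i) + 2 * pi" by (simp add: distrib_left)
    moreover have "(b ^^ k) (2 * pi) = (b ^^ k) 0 + 2 * pi * real (d ^ k)"
      "(b ^^ i) (2 * pi) = (b ^^ i) 0 + 2 * pi * real (d ^ i)"
      using iter_b_period[of k 0] iter_b_period[of i 0] by simp_all
    ultimately have "(b ^^ k) 0 - (b ^^ i) 0 + pi \<le> (b ^^ k) (2 * pi) - (b ^^ i) (2 * pi)"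
      using pi_gt_zero by linarith
    then have "\<exists>t. cis ((b ^^ k) t - (b ^^ i) t) \<noteq> cis ((b ^^ k) 0 - (b ^^ i) 0)"
      by (intro cis_comp_not_constant continuous_on_diff iter_b_cont)
    with * show False by simp
  qed
  then have "finite {z. poly (P * Q' - P' * Q) z = 0}" by (rule poly_roots_finite)
  then show ?thesis by (rule rev_finite_subset) (use eq in blast)
qed

lemma finite_fibre: "finite {z. cmod z = 1 \<and> B z = c}"
proof -
  obtain P Q where PQ: "\<And>z. cmod z = 1 \<Longrightarrow> poly Q z \<noteq> 0 \<and> (B ^^ 1) z = poly P z / poly Q z"
    using B_rational by meson
  have eq: "B z = c \<longleftrightarrow> poly (P - smult c Q) z = 0" if "cmod z = 1" for z
    using PQ[OF that] by (auto simp: field_simps)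
  have "P - smult c Q \<noteq> 0"
  proof
    assume "P - smult c Q = 0"
    then have "cis (b t) = c" for t using eq[of "cis t"] by (simp add: B_cis)
    moreover have "2 * pi \<le> 2 * pi * real d" using degree by simp
    then have "b 0 + pi \<le> b (2 * pi)" using b_period[of 0] pi_gt_zero by simp
    then have "\<exists>t. cis (b t) \<noteq> cis (b 0)" using b_cont by (rule cis_comp_not_constant[rotated])
    ultimately show False by simp
  qed
  then have "finite {z. poly (P - smult c Q) z = 0}" by (rule poly_roots_finite)
  then show ?thesis by (rule rev_finite_subset) (use eq in blast)
qed

text \<open>\<open>b t - t\<close> gains 2 pi (d - 1) > 0 per period, so it is positive far to the
  right and takes nonpositive values far to the left; the last point with \<open>b t \<le> t\<close>
  is fixed by continuity.\<close>

lemma repelling_fixed_point: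
  "\<exists>p. b p = p \<and> (\<forall>t>p. t < b t)"
proof -
  define S where "S = {t. b t \<le> t}"
  have "closed S" unfolding S_def using b_cont by (intro closed_Collect_le continuous_on_id)
  have d1: "1 \<le> real d - 1" using degree by simp
  have "S \<noteq> {}"
  proof -
    obtain n :: nat where n: "b 0 \<le> real n" using real_arch_simple by blast
    have "b 0 = b (- (2 * pi * real n)) + 2 * pi * d * n"
      using b_period_nat[of "- (2 * pi * real n)" n] by simp
    moreover have "1 * real n \<le> (2 * pi * (real d - 1)) * real n"
      using mult_mono[of 1 "2 * pi" 1 "real d - 1"] d1 pi_ge_two by (intro mult_right_mono) auto
    ultimately have "b (- (2 * pi * real n)) \<le> - (2 * pi * real n)" using n by (simp add: algebra_simps)
    then show ?thesis by (auto simp: S_def)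
  qed
  moreover have "bdd_above S"
  proof -
    \<comment> \<open>For t in the period starting at 2 pi n with n \<ge> \<open>n0\<close>,
      monotonicity gives b t \<ge> b 0 + 2 pi n + n, which exceeds 2 pi n + 2 pi and hence
      t.\<close>
    obtain n0 :: nat where n0: "2 * pi - b 0 < real n0" using reals_Archimedean2 by blast
    have "t \<le> 2 * pi * real n0" if t: "t \<in> S" for t
    proof (rule ccontr)
      assume "\<not> t \<le> 2 * pi * real n0"
      then have t0: "2 * pi * real n0 < t" by simp
      define n where "n = nat \<lfloor>t / (2 * pi)\<rfloor>"
      have "0 \<le> 2 * pi * real n0" by simp
      then have "t \<ge> 0" using t0 by linarith
      then have fl: "real n \<le> t / (2 * pi)" "t / (2 * pi) < real n + 1" 
        unfolding n_def by (auto simp: of_nat_nat)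
      then have tn: "2 * pi * real n \<le> t" "t < 2 * pi * real n + 2 * pi" by (auto simp: field_simps)
      have "real n0 < t / (2 * pi)" using t0 by (simp add: field_simps)
      then have "real n0 < real n + 1" using fl by linarith
      then have "n0 \<le> n" by linarith
      have "b (2 * pi * real n) \<le> b t" using tn b_mono by (simp add: strict_mono_less_eq)
      moreover have "b (2 * pi * real n) = b 0 + 2 * pi * d * n" using b_period_nat[of 0 n] by simp
      moreover have "1 * real n \<le> (2 * pi * (real d - 1)) * real n"
        using mult_mono[of 1 "2 * pi" 1 "real d - 1"] d1 pi_ge_two by (intro mult_right_mono) auto
      ultimately have "b t > t" using tn n0 \<open>n0 \<le> n\<close> by (simp add: algebra_simps)
      with t show False by (simp add: S_def)
    qed
    then show ?thesis by (rule bdd_aboveI)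
  qed
  ultimately have "Sup S \<in> S" using \<open>closed S\<close> by (intro closed_contains_Sup)
  then have le: "b (Sup S) \<le> Sup S" by (simp add: S_def)
  have gt: "t < b t" if "Sup S < t" for t
    using cSup_upper[OF _ \<open>bdd_above S\<close>, of t] that by (force simp: S_def)
  \<comment> \<open>Letting t decrease to \<open>Sup S\<close> in t < b t gives the missing
    inequality.\<close>
  have "(b \<longlongrightarrow> b (Sup S)) (at_right (Sup S))"
    using b_cont by (simp add: continuous_on_eq_continuous_at continuous_at filterlim_at_split)
  then have "Sup S \<le> b (Sup S)"
  proof (rule tendsto_lowerbound)
    show "\<forall>\<^sub>F t in at_right (Sup S). Sup S \<le> b t"
      unfolding eventually_at_right_field using gt by (intro exI[of _ "Sup S + 1"]) force
  qed auto
  with le gt show ?thesis by (intro exI[of _ "Sup S"]) simp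
qed

section \<open>The inverse of the lift and backward orbits\<close>

lemma surj_b: "surj b"
proof -
  have "\<exists>t. b t = y" for y
  proof -
    obtain n :: nat where n: "\<bar>y\<bar> + \<bar>b 0\<bar> \<le> real n" using real_arch_simple by blast
    have "1 * real n \<le> (2 * pi * real d) * real n"
      using mult_mono[of 1 "2 * pi" 1 "real d"] degree pi_ge_two by (intro mult_right_mono) auto
    then have "b (- (2 * pi * real n)) \<le> y" "y \<le> b (2 * pi * real n)"
      using b_period_nat[of 0 n] b_period_nat[of "- (2 * pi * real n)" n] n by (simp_all add: algebra_simps)
    moreover have "- (2 * pi * real n) \<le> 2 * pi * real n" by simp
    ultimately show ?thesis
      using IVT'[of b "- (2 * pi * real n)" y "2 * pi * real n"] b_cont continuous_on_subset by blast
  qed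
  then show ?thesis by (metis surj_def)
qed

lemma b_inv: "b (inv b t) = t" "inv b (b t) = t"
  using surj_b b_mono by (simp_all add: surj_f_inv_f strict_mono_imp_inj_on)

lemma inv_b_less: "inv b s < t \<longleftrightarrow> s < b t" "t < inv b s \<longleftrightarrow> b t < s"
  using strict_mono_less[OF b_mono] b_inv by metis+

lemma inv_b_tendsto:
  assumes "(f \<longlongrightarrow> b t) F"
  shows "((\<lambda>x. inv b (f x)) \<longlongrightarrow> t) F"
proof (rule order_tendstoI)
  fix a assume "a < t"
  then have "b a < b t" using b_mono by (simp add: strict_mono_less)
  then show "\<forall>\<^sub>F x in F. a < inv b (f x)" using order_tendstoD(1)[OF assms] by (simp add: inv_b_less)
next
  fix a assume "t < a"
  then have "b t < b a" using b_mono by (simp add: strict_mono_less)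
  then show "\<forall>\<^sub>F x in F. inv b (f x) < a" using order_tendstoD(2)[OF assms] by (simp add: inv_b_less)
qed

text \<open>The sequence decreases and is bounded below by \<open>p\<close>; its limit is a fixed
  point of \<open>b\<close> not below \<open>p\<close>, and \<open>p\<close> is the only one
  there.\<close>

lemma backward_orbit:
  assumes p: "b p = p" "\<And>t. p < t \<Longrightarrow> t < b t" and t: "p < t"
  shows "p < (inv b ^^ n) t" "(\<lambda>n. (inv b ^^ n) t) \<longlonglongrightarrow> p"
proof -
  define x where "x n = (inv b ^^ n) t" for n
  have gt: "p < x n" for n
    by (induction n) (auto simp: x_def t inv_b_less p)
  then show "p < (inv b ^^ n) t" by (simp add: x_def)
  have bx: "b (x (Suc n)) = x n" for n by (simp add: x_def b_inv)
  have "decseq x" using p(2)[OF gt] bx by (intro decseq_SucI) (metis less_imp_le)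
  moreover have "\<And>i. p \<le> x i" using gt less_imp_le by blast
  ultimately obtain L where L: "x \<longlonglongrightarrow> L" using decseq_convergent by blast
  have "p \<le> L" using L gt by (intro LIMSEQ_le_const) (auto intro: less_imp_le)
  have "(\<lambda>n. b (x (Suc n))) \<longlonglongrightarrow> b L"
    using continuous_on_tendsto_compose[OF b_cont LIMSEQ_Suc[OF L]] by simp
  then have "b L = L" unfolding bx using L LIMSEQ_unique by blast
  with p(2)[of L] \<open>p \<le> L\<close> have "L = p" by (cases "p < L") auto
  with L show "(\<lambda>n. (inv b ^^ n) t) \<longlonglongrightarrow> p" by (simp add: x_def[abs_def])
qed

section \<open>Periodic orbits\<close>

definition periodic :: "complex \<Rightarrow> bool" where
  "periodic q \<longleftrightarrow> cmod q = 1 \<and> (\<exists>N>0. (B ^^ N) q = q)"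

definition orb :: "complex \<Rightarrow> complex set" where
  "orb q = range (\<lambda>k. (B ^^ k) q)"

text \<open>Over a period starting at a fixed point, the displacement \<open>(b ^^ k) t - t\<close>
  goes from 0 to 2 pi (d^k - 1). It takes every value 2 pi l with l < d^k - 1, and each of these
  gives a point fixed by \<open>B ^^ k\<close>.\<close>

lemma infinite_periodic: "infinite {q. periodic q}"
proof
  assume fin: "finite {q. periodic q}"
  \<comment> \<open>Since k < 2^k \<le> d^k, this \<open>k\<close> yields more points than the
    supposed number of periodic ones.\<close>
  define k where "k = card {q. periodic q} + 1"
  define D where "D = d ^ k - 1"
  have "k < 2 ^ k" by (rule less_exp)
  also have "(2::nat) ^ k \<le> d ^ k" using degree by (rule power_mono) simp
  finally have kD: "card {q. periodic q} < D" by (simp add: D_def k_def)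
  have rD: "real D = real d ^ k - 1" unfolding D_def using degree by (simp add: of_nat_diff)
  obtain p where p: "b p = p" using repelling_fixed_point by blast
  have pk: "(b ^^ k) p = p" by (induction k) (auto simp: p)
  have "\<exists>t. p \<le> t \<and> t < p + 2 * pi \<and> (b ^^ k) t - t = 2 * pi * real l" if "l < D" for l
  proof -
    have cont: "continuous_on {p..p + 2 * pi} (\<lambda>t. (b ^^ k) t - t)"
      using iter_b_cont by (intro continuous_intros continuous_on_subset[OF iter_b_cont]) auto
    have end': "(b ^^ k) (p + 2 * pi) - (p + 2 * pi) = 2 * pi * real D"
      using iter_b_period[of k p] pk by (simp add: rD algebra_simps)
    have "\<exists>t. p \<le> t \<and> t \<le> p + 2 * pi \<and> (b ^^ k) t - t = 2 * pi * real l"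
      using that by (intro IVT'[OF _ _ _ cont]) (simp_all only: end' pk, auto)
    then obtain t where t: "p \<le> t" "t \<le> p + 2 * pi" "(b ^^ k) t - t = 2 * pi * real l" by blast
    \<comment> \<open>Dropping the right endpoint keeps all \<open>t l\<close> in a half-open
      period, where \<open>cis\<close> is injective.\<close>
    moreover have "t \<noteq> p + 2 * pi" using t(3) end' that by auto
    ultimately show ?thesis by force
  qed
  then obtain t where t: "\<And>l. l < D \<Longrightarrow> p \<le> t l \<and> t l < p + 2 * pi \<and> (b ^^ k) (t l) - t l = 2 * pi * real l"
    by metis
  have "inj_on (\<lambda>l. cis (t l)) {..<D}"
  proof (rule inj_onI)
    fix l l' assume l: "l \<in> {..<D}" "l' \<in> {..<D}" and "cis (t l) = cis (t l')"
    then have "t l = t l'" using t[of l] t[of l'] by (intro cis_eq_imp_eq) auto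
    moreover have "(b ^^ k) (t l) - t l = 2 * pi * real l" "(b ^^ k) (t l') - t l' = 2 * pi * real l'"
      using t l by blast+
    ultimately have "2 * pi * real l = 2 * pi * real l'" by metis
    then show "l = l'" by simp
  qed
  moreover have "(\<lambda>l. cis (t l)) ` {..<D} \<subseteq> {q. periodic q}"
  proof safe
    fix l assume "l < D"
    then have "(b ^^ k) (t l) = t l + 2 * pi * real l" using t[of l] by simp
    then have "(B ^^ k) (cis (t l)) = cis (t l) * cis (2 * pi * real l)" by (simp only: iter_cis cis_mult)
    also have "cis (2 * pi * real l) = 1" by (rule cis_multiple_2pi) simp
    finally have "(B ^^ k) (cis (t l)) = cis (t l)" by simp
    moreover have "k > 0" by (simp add: k_def)
    ultimately show "periodic (cis (t l))" unfolding periodic_def by auto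
  qed
  ultimately have "card {..<D} \<le> card {q. periodic q}" using fin by (intro card_inj_on_le)
  with kD show False by simp
qed

lemma orb_self: "q \<in> orb q"
  unfolding orb_def by (metis funpow_0 rangeI)

lemma orb_trans: "x \<in> orb q \<Longrightarrow> y \<in> orb x \<Longrightarrow> y \<in> orb q"
  unfolding orb_def by (auto simp: funpow_add[THEN fun_cong, unfolded o_apply, symmetric])

lemma B_orb: "x \<in> orb q \<Longrightarrow> B x \<in> orb q"
  unfolding orb_def by (auto intro: range_eqI[of _ _ "Suc _"])

lemma orb_sphere: "periodic q \<Longrightarrow> x \<in> orb q \<Longrightarrow> cmod x = 1"
  by (auto simp: orb_def periodic_def iter_sphere)

lemma iter_period_mult:
  assumes "(B ^^ N) q = q"
  shows "(B ^^ (N * k)) q = q"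
proof (induction k)
  case (Suc k)
  have "(B ^^ (N * Suc k)) q = (B ^^ (N * k)) ((B ^^ N) q)"
    unfolding mult_Suc_right by (subst add.commute) (simp only: funpow_add o_apply)
  with Suc assms show ?case by simp
qed simp

lemma orb_sym:
  assumes q: "periodic q" and x: "x \<in> orb q"
  shows "q \<in> orb x"
proof -
  obtain N where N: "N > 0" "(B ^^ N) q = q" using q by (auto simp: periodic_def)
  obtain k where k: "x = (B ^^ k) q" using x by (auto simp: orb_def)
  \<comment> \<open>\<open>N * k\<close> is a multiple of the period and not below \<open>k\<close>,
    so \<open>N * k - k\<close> further steps lead from \<open>x\<close> back to
    \<open>q\<close>.\<close>
  have "k \<le> N * k" using N by simp
  then have "(B ^^ (N * k - k)) x = (B ^^ (N * k)) q"
    unfolding k by (metis add_diff_inverse_nat comp_apply funpow_add le_add_diff_inverse2)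
  then show ?thesis using iter_period_mult[OF N(2)] unfolding orb_def by (metis rangeI)
qed

lemma orb_predecessor:
  assumes q: "periodic q" and x: "x \<in> orb q"
  obtains y where "y \<in> orb q" "B y = x"
proof -
  obtain N where N: "N > 0" "(B ^^ N) q = q" using q by (auto simp: periodic_def)
  obtain k where k: "x = (B ^^ k) q" using x by (auto simp: orb_def)
  have "(B ^^ (k + N)) q = x" by (simp add: funpow_add N k)
  then have "B ((B ^^ (k + N - 1)) q) = x" using N(1) by (cases "k + N") auto
  then show thesis using that by (auto simp: orb_def)
qed

lemma finite_orb:
  assumes "periodic q"
  shows "finite (orb q)"
proof -
  obtain N where N: "N > 0" "(B ^^ N) q = q" using assms by (auto simp: periodic_def)
  have "(B ^^ k) q = (B ^^ (k mod N)) q" for k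
  proof -
    have "(B ^^ k) q = (B ^^ (k mod N + N * (k div N))) q" by simp
    also have "\<dots> = (B ^^ (k mod N)) ((B ^^ (N * (k div N))) q)" by (simp only: funpow_add o_apply)
    finally show ?thesis by (simp only: iter_period_mult[OF N(2)])
  qed
  then have "orb q \<subseteq> (\<lambda>k. (B ^^ k) q) ` {..<N}"
    unfolding orb_def using N(1) by (metis (no_types, lifting) image_eqI image_subsetI lessThan_iff mod_less_divisor)
  then show ?thesis by (rule finite_subset) simp
qed

lemma disjoint_periodic_orbits:
  assumes p: "B p = p"
  shows "\<exists>q :: nat \<Rightarrow> complex. (\<forall>i. periodic (q i) \<and> p \<notin> orb (q i)) \<and> (\<forall>i j. i \<noteq> j \<longrightarrow> orb (q i) \<inter> orb (q j) = {})"
proof -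
  define good where "good A x \<longleftrightarrow> periodic x \<and> x \<noteq> p \<and> (\<forall>y\<in>A. x \<notin> orb y)" for A x
  have ex: "\<exists>x. good A x" if "finite A" "\<forall>y\<in>A. periodic y" for A
  proof -
    have "finite (insert p (\<Union>y\<in>A. orb y))" using that finite_orb by auto
    then have "\<not> {q. periodic q} \<subseteq> insert p (\<Union>y\<in>A. orb y)"
      using infinite_periodic finite_subset by blast
    then show ?thesis by (auto simp: good_def)
  qed
  \<comment> \<open>Recursion over all earlier values: each new periodic point avoids
    \<open>p\<close> and the finitely many points on the earlier orbits. As periodic orbits are
    cycles, the whole orbits are then disjoint.\<close>
  define q where "q = wfrec less_than (\<lambda>q n. SOME x. good (q ` {..<n}) x)"
  have q_rec: "q n = (SOME x. good (q ` {..<n}) x)" for n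
  proof -
    have "cut q less_than n ` {..<n} = q ` {..<n}" by (auto simp: cut_def image_def)
    then show ?thesis unfolding q_def by (subst wfrec[OF wf_less_than]) simp
  qed
  have good: "good (q ` {..<n}) (q n)" for n
  proof (induction n rule: less_induct)
    case (less n)
    then have "\<exists>x. good (q ` {..<n}) x" by (intro ex) (auto simp: good_def)
    then show ?case using q_rec[of n] by (metis someI_ex)
  qed
  have per: "periodic (q n)" "q n \<noteq> p" for n using good[of n] by (auto simp: good_def)
  have orbp: "orb p = {p}"
  proof -
    have "(B ^^ k) p = p" for k by (induction k) (auto simp: p)
    then show ?thesis by (auto simp: orb_def)
  qed
  have p_orb: "p \<notin> orb (q n)" for n using orb_sym[OF per(1)] orbp per(2) by fastforce
  have "orb (q i) \<inter> orb (q j) = {}" if "i < j" for i j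
  proof (rule ccontr)
    assume "orb (q i) \<inter> orb (q j) \<noteq> {}"
    then obtain x where "x \<in> orb (q i)" "x \<in> orb (q j)" by auto
    then have "q j \<in> orb (q i)" using orb_sym[OF per(1)] orb_trans by blast
    then show False using good[of j] that by (auto simp: good_def)
  qed
  then have disj: "orb (q i) \<inter> orb (q j) = {}" if "i \<noteq> j" for i j
    using that by (metis Int_commute nat_neq_iff)
  with p_orb per(1) show ?thesis by blast
qed

subsection \<open>Moduli of the spectrum\<close>

lemma weighted_composition_disc_alg:
  assumes "w \<in> disc_alg" "f \<in> disc_alg"
  shows "(\<lambda>z. w z * f (B z)) \<in> disc_alg"
proof -
  have "(\<lambda>z. f (B z)) holomorphic_on ball 0 1"
    using assms(2) B_disc_alg B_ball holomorphic_on_compose_gen[of B "ball 0 1" f "ball 0 1"]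
    by (simp add: disc_alg_def o_def)
  moreover have "continuous_on (cball 0 1) (\<lambda>z. f (B z))"
    using assms(2) B_disc_alg B_cball continuous_on_compose2[of "cball 0 1" f "cball 0 1" B]
    by (simp add: disc_alg_def image_subset_iff)
  ultimately have "(\<lambda>z. f (B z)) \<in> disc_alg" by (simp add: disc_alg_def)
  with assms(1) show ?thesis by (rule disc_alg_intros(4))
qed

text \<open>\<open>S\<close> will be a union of cycles. The moduli of the approximate eigenvectors
  have limit 1 at some point. If it lies in \<open>S\<close>, following its cycle in one of the two
  directions makes the limits grow unless |\<mu>| = |w| there. Otherwise its backward orbit towards
  \<open>cis p\<close> meets no zero of \<open>w\<close>, and close to \<open>cis p\<close> the
  limits grow when |\<mu>| < R.\<close>

lemma usf_spectrum_modulus: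
  assumes w: "w \<in> disc_alg"
    and sph: "\<And>q. q \<in> S \<Longrightarrow> cmod q = 1"
    and inv: "\<And>q. q \<in> S \<Longrightarrow> B q \<in> S" "\<And>q. q \<in> S \<Longrightarrow> cmod (w (B q)) = cmod (w q)"
    and pred: "\<And>q. q \<in> S \<Longrightarrow> \<exists>y\<in>S. B y = q"
    and zeros: "\<And>z. R > 0 \<Longrightarrow> cmod z = 1 \<Longrightarrow> w z = 0 \<Longrightarrow> B z \<in> S"
    and R: "\<And>z. cmod z = 1 \<Longrightarrow> cmod (w z) \<le> R" "cmod (w (cis p)) = R"
    and p: "b p = p" "\<And>t. p < t \<Longrightarrow> t < b t"
    and \<mu>: "\<mu> \<in> usf_spectrum (\<lambda>f z. w z * f (B z))"
  shows "cmod \<mu> = R \<or> (\<exists>q\<in>S. cmod \<mu> = cmod (w q))"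
proof (rule ccontr)
  assume neg: "\<not> ?thesis"
  obtain x where x: "\<And>n. x n \<in> disc_alg" "\<And>n. supnorm (x n) = 1"
    and lim: "(\<lambda>n. supnorm (\<lambda>z. w z * x n (B z) - \<mu> * x n z)) \<longlonglongrightarrow> 0"
    using \<mu> unfolding usf_spectrum_def by blast
  define E where "E n = supnorm (\<lambda>z. w z * x n (B z) - \<mu> * x n z)" for n
  have E: "cmod (w z * x n (B z) - \<mu> * x n z) \<le> E n" if "cmod z = 1" for z n
    unfolding E_def using that
    by (intro norm_le_supnorm[where h = "\<lambda>z. w z * x n (B z) - \<mu> * x n z"] disc_alg_intros weighted_composition_disc_alg w x) auto
  have x1: "cmod (x n z) \<le> 1" if "cmod z = 1" for n z
    using norm_le_supnorm[OF x(1), of z n] x(2) that by simp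
  have "\<exists>z. cmod z = 1 \<and> cmod (x n z) = 1" for n
    using supnorm_attained[OF x(1)[of n]] x(2)[of n] by metis
  then obtain s where s: "\<And>n. cmod (s n) = 1" "\<And>n. cmod (x n (s n)) = 1" by metis
  have R0: "R \<ge> 0" using norm_ge_zero[of "w (cis p)"] unfolding R(2) .
  \<comment> \<open>Evaluation at a maximum point \<open>s n\<close> bounds |\<mu>| by
    \<open>R\<close> up to the error; the negated goal then makes the inequality strict.\<close>
  have "cmod \<mu> \<le> R + E n" for n
  proof -
    have "cmod \<mu> = cmod (\<mu> * x n (s n))" by (simp add: norm_mult s)
    also have "\<dots> \<le> cmod (w (s n) * x n (B (s n))) + E n"
      using E[OF s(1), of n n] norm_triangle_ineq4[of "w (s n) * x n (B (s n))" "w (s n) * x n (B (s n)) - \<mu> * x n (s n)"] by simp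
    also have "cmod (w (s n) * x n (B (s n))) \<le> R * 1"
      unfolding norm_mult using R(1)[OF s(1)] x1[OF B_sphere[OF s(1)]] R0 by (intro mult_mono) auto
    finally show ?thesis by simp
  qed
  moreover have "(\<lambda>n. R + E n) \<longlonglongrightarrow> R + 0" using lim by (intro tendsto_intros) (simp add: E_def)
  ultimately have "cmod \<mu> \<le> R" using LIMSEQ_le_const[of "\<lambda>n. R + E n" R "cmod \<mu>"] by auto
  with neg have \<mu>R: "cmod \<mu> < R" by auto
  then have "R > 0" using norm_ge_zero[of \<mu>] by linarith
  \<comment> \<open>By compactness the angles of the maximum points converge along a subsequence;
    limit modulus 1 occurs at their limit \<tau>.\<close>
  have "\<forall>n. Arg (s n) \<in> {-pi..pi}" using Arg_bounded less_imp_le by auto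
  then obtain \<tau> r where r: "strict_mono r" "((\<lambda>n. Arg (s n)) \<circ> r) \<longlonglongrightarrow> \<tau>"
    using compact_Icc[of "-pi" pi, unfolded compact_def] by metis
  define f where "f n = x (r n)" for n
  have f1: "cmod (f n (cis t)) \<le> 1" for n t unfolding f_def by (intro x1) simp
  have E0: "(\<lambda>n. E (r n)) \<longlonglongrightarrow> 0"
    using LIMSEQ_subseq_LIMSEQ[OF lim r(1)] by (simp add: E_def o_def)
  have wcont: "(\<lambda>n. cmod (w (cis (\<psi> n)))) \<longlonglongrightarrow> cmod (w (cis \<phi>))" if "\<psi> \<longlonglongrightarrow> \<phi>" for \<psi> \<phi>
  proof -
    have "continuous_on (cball 0 1) w" using w by (simp add: disc_alg_def)
    then have "continuous_on UNIV (\<lambda>t. cmod (w (cis t)))"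
      by (intro continuous_on_norm continuous_on_compose2[of "cball 0 1" w UNIV cis] continuous_intros) auto
    then show ?thesis using that continuous_on_tendsto_compose by fastforce
  qed
  \<comment> \<open>\<open>c\<close> is a limit of \<open>|f\<^sub>n|\<close> at \<open>cis \<phi>\<close>; phrased through lifts so that \<open>inv b\<close> transports it backwards.\<close>
  define Q where "Q \<phi> c \<longleftrightarrow> (\<exists>\<psi>. \<psi> \<longlonglongrightarrow> \<phi> \<and> (\<lambda>n. cmod (f n (cis (\<psi> n)))) \<longlonglongrightarrow> c)" for \<phi> c
  have Q\<tau>: "Q \<tau> 1"
  proof -
    have "cis (Arg (s n)) = s n" for n using s(1)[of n] rcis_cmod_Arg[of "s n"] by (simp add: rcis_def)
    then show ?thesis unfolding Q_def using r(2) s(2)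
      by (intro exI[of _ "\<lambda>n. Arg (s (r n))"]) (simp add: f_def o_def)
  qed
  have Q_le: "c \<le> 1" if "Q \<phi> c" for \<phi> c
    using that f1 unfolding Q_def by (auto intro!: LIMSEQ_le_const2)
  have Q_cis: "Q \<phi>' c" if Q: "Q \<phi> c" and e: "cis \<phi> = cis \<phi>'" for \<phi> \<phi>' c
  proof -
    obtain \<psi> where \<psi>: "\<psi> \<longlonglongrightarrow> \<phi>" "(\<lambda>n. cmod (f n (cis (\<psi> n)))) \<longlonglongrightarrow> c" using Q unfolding Q_def by blast
    have "cis (\<phi>' - \<phi>) = 1" unfolding cis_divide[symmetric] e by (rule divide_self) simp
    then have "cis (\<psi> n + (\<phi>' - \<phi>)) = cis (\<psi> n)" for n unfolding cis_mult[symmetric] by simp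
    moreover have "(\<lambda>n. \<psi> n + (\<phi>' - \<phi>)) \<longlonglongrightarrow> \<phi> + (\<phi>' - \<phi>)" using \<psi> by (intro tendsto_intros)
    ultimately show ?thesis unfolding Q_def using \<psi>(2) by (intro exI[of _ "\<lambda>n. \<psi> n + (\<phi>' - \<phi>)"]) simp
  qed
  \<comment> \<open>The approximate eigenvalue equation for moduli, along any sequence of
    angles.\<close>
  have rel: "(\<lambda>n. cmod (w (cis (\<psi> n))) * cmod (f n (cis (b (\<psi> n)))) - cmod \<mu> * cmod (f n (cis (\<psi> n)))) \<longlonglongrightarrow> 0" for \<psi>
  proof (rule Lim_null_comparison[OF _ E0], intro always_eventually allI)
    fix n
    show "norm (cmod (w (cis (\<psi> n))) * cmod (f n (cis (b (\<psi> n)))) - cmod \<mu> * cmod (f n (cis (\<psi> n)))) \<le> E (r n)"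
      using E[of "cis (\<psi> n)" "r n"] norm_triangle_ineq3[of "w (cis (\<psi> n)) * f n (cis (b (\<psi> n)))" "\<mu> * f n (cis (\<psi> n))"]
      by (simp add: B_cis f_def norm_mult)
  qed
  have fwd: "Q (b \<phi>) (cmod \<mu> * c / cmod (w (cis \<phi>)))" if Q: "Q \<phi> c" and nz: "w (cis \<phi>) \<noteq> 0" for \<phi> c
  proof -
    obtain \<psi> where \<psi>: "\<psi> \<longlonglongrightarrow> \<phi>" "(\<lambda>n. cmod (f n (cis (\<psi> n)))) \<longlonglongrightarrow> c" using Q unfolding Q_def by blast
    have "(\<lambda>n. cmod (w (cis (\<psi> n))) * cmod (f n (cis (b (\<psi> n))))) \<longlonglongrightarrow> cmod \<mu> * c"
      using tendsto_add[OF rel[of \<psi>] tendsto_mult_left[OF \<psi>(2), of "cmod \<mu>"]] by simp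
    from tendsto_divide[OF this wcont[OF \<psi>(1)]]
    have "(\<lambda>n. cmod (w (cis (\<psi> n))) * cmod (f n (cis (b (\<psi> n)))) / cmod (w (cis (\<psi> n)))) \<longlonglongrightarrow> cmod \<mu> * c / cmod (w (cis \<phi>))"
      using nz by simp
    moreover have "\<forall>\<^sub>F n in sequentially. 0 < cmod (w (cis (\<psi> n)))"
      using nz by (intro order_tendstoD(1)[OF wcont[OF \<psi>(1)]]) simp
    then have "\<forall>\<^sub>F n in sequentially. cmod (w (cis (\<psi> n))) * cmod (f n (cis (b (\<psi> n)))) / cmod (w (cis (\<psi> n))) = cmod (f n (cis (b (\<psi> n))))"
      by eventually_elim simp
    ultimately have "(\<lambda>n. cmod (f n (cis (b (\<psi> n))))) \<longlonglongrightarrow> cmod \<mu> * c / cmod (w (cis \<phi>))"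
      using tendsto_cong by force
    moreover have "(\<lambda>n. b (\<psi> n)) \<longlonglongrightarrow> b \<phi>" using continuous_on_tendsto_compose[OF b_cont \<psi>(1)] by simp
    ultimately show ?thesis unfolding Q_def by blast
  qed
  have fwd0: "cmod \<mu> * c = 0" if Q: "Q \<phi> c" and z: "w (cis \<phi>) = 0" for \<phi> c
  proof -
    obtain \<psi> where \<psi>: "\<psi> \<longlonglongrightarrow> \<phi>" "(\<lambda>n. cmod (f n (cis (\<psi> n)))) \<longlonglongrightarrow> c" using Q unfolding Q_def by blast
    have "(\<lambda>n. cmod (w (cis (\<psi> n))) * cmod (f n (cis (b (\<psi> n))))) \<longlonglongrightarrow> cmod \<mu> * c"
      using tendsto_add[OF rel[of \<psi>] tendsto_mult_left[OF \<psi>(2), of "cmod \<mu>"]] by simp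
    moreover have "(\<lambda>n. cmod (w (cis (\<psi> n))) * cmod (f n (cis (b (\<psi> n))))) \<longlonglongrightarrow> 0"
    proof (rule Lim_null_comparison)
      show "(\<lambda>n. cmod (w (cis (\<psi> n)))) \<longlonglongrightarrow> 0" using wcont[OF \<psi>(1)] z by simp
      show "\<forall>\<^sub>F n in sequentially. norm (cmod (w (cis (\<psi> n))) * cmod (f n (cis (b (\<psi> n))))) \<le> cmod (w (cis (\<psi> n)))"
        using f1 by (intro always_eventually) (simp add: mult_left_le)
    qed
    ultimately show ?thesis using LIMSEQ_unique by blast
  qed
  \<comment> \<open>A sequence tending to \<open>b \<phi>\<close> is pulled back by
    \<open>inv b\<close>, which selects the branch of preimages through \<phi>.\<close>
  have bwd_aux: "\<exists>\<psi>. \<psi> \<longlonglongrightarrow> \<phi> \<and> (\<lambda>n. cmod \<mu> * cmod (f n (cis (\<psi> n)))) \<longlonglongrightarrow> cmod (w (cis \<phi>)) * c"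
    if Q: "Q (b \<phi>) c" for \<phi> c
  proof -
    obtain \<psi> where \<psi>: "\<psi> \<longlonglongrightarrow> b \<phi>" "(\<lambda>n. cmod (f n (cis (\<psi> n)))) \<longlonglongrightarrow> c" using Q unfolding Q_def by blast
    define \<xi> where "\<xi> n = inv b (\<psi> n)" for n
    have \<xi>: "\<xi> \<longlonglongrightarrow> \<phi>" "\<And>n. b (\<xi> n) = \<psi> n" using inv_b_tendsto[OF \<psi>(1)] by (auto simp: \<xi>_def[abs_def] b_inv)
    have "(\<lambda>n. cmod (w (cis (\<xi> n))) * cmod (f n (cis (b (\<xi> n))))) \<longlonglongrightarrow> cmod (w (cis \<phi>)) * c"
      using tendsto_mult[OF wcont[OF \<xi>(1)] \<psi>(2)] by (simp add: \<xi>)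
    from tendsto_diff[OF this rel[of \<xi>]]
    have "(\<lambda>n. cmod \<mu> * cmod (f n (cis (\<xi> n)))) \<longlonglongrightarrow> cmod (w (cis \<phi>)) * c" by simp
    with \<xi> show ?thesis by blast
  qed
  have bwd: "Q \<phi> (cmod (w (cis \<phi>)) * c / cmod \<mu>)" if Q: "Q (b \<phi>) c" and nz: "\<mu> \<noteq> 0" for \<phi> c
  proof -
    obtain \<psi> where \<psi>: "\<psi> \<longlonglongrightarrow> \<phi>" "(\<lambda>n. cmod \<mu> * cmod (f n (cis (\<psi> n)))) \<longlonglongrightarrow> cmod (w (cis \<phi>)) * c"
      using bwd_aux[OF Q] by blast
    from tendsto_divide[OF \<psi>(2) tendsto_const[of "cmod \<mu>"]] nz
    have "(\<lambda>n. cmod (f n (cis (\<psi> n)))) \<longlonglongrightarrow> cmod (w (cis \<phi>)) * c / cmod \<mu>" by simp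
    with \<psi> show ?thesis unfolding Q_def by blast
  qed
  have bwd0: "cmod (w (cis \<phi>)) * c = 0" if Q: "Q (b \<phi>) c" and z: "\<mu> = 0" for \<phi> c
    using bwd_aux[OF Q] z by (auto simp: LIMSEQ_const_iff)
  \<comment> \<open>No limit exceeds 1, so a step that multiplies by at least \<kappa> > 1 cannot be
    repeated forever within \<open>A\<close>.\<close>
  have growth: False
    if step: "\<And>\<phi> c. \<phi> \<in> A \<Longrightarrow> c > 0 \<Longrightarrow> Q \<phi> c \<Longrightarrow> \<exists>\<phi>'\<in>A. \<exists>c'. \<kappa> * c \<le> c' \<and> Q \<phi>' c'"
      and \<kappa>: "\<kappa> > 1" and start: "\<phi> \<in> A" "c > 0" "Q \<phi> c" for A \<kappa> \<phi> c
  proof -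
    have "\<exists>\<phi>'\<in>A. \<exists>c'. \<kappa> ^ n * c \<le> c' \<and> Q \<phi>' c'" for n
    proof (induction n)
      case 0
      then show ?case using start by auto
    next
      case (Suc n)
      then obtain \<phi>' c' where *: "\<phi>' \<in> A" "\<kappa> ^ n * c \<le> c'" "Q \<phi>' c'" by blast
      moreover have "0 < \<kappa> ^ n * c" using \<kappa> start by simp
      ultimately obtain \<phi>'' c'' where **: "\<phi>'' \<in> A" "\<kappa> * c' \<le> c''" "Q \<phi>'' c''" using step[of \<phi>' c'] by fastforce
      have "\<kappa> * (\<kappa> ^ n * c) \<le> \<kappa> * c'" using * \<kappa> by (intro mult_left_mono) auto
      with ** show ?case by (intro bexI[of _ \<phi>''] exI[of _ c'']) (auto simp: mult.assoc)
    qed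
    then have "\<kappa> ^ n * c \<le> 1" for n using Q_le order_trans by meson
    moreover obtain n where "1 / c < \<kappa> ^ n" using real_arch_pow[OF \<kappa>] by blast
    ultimately show False using start(2) by (metis leD pos_divide_less_eq)
  qed
  show False
  proof (cases "cis \<tau> \<in> S")
    case True
    define \<rho> where "\<rho> = cmod (w (cis \<tau>))"
    \<comment> \<open>\<open>A\<close> can be followed in both directions: \<open>B\<close>
      preserves |w| on \<open>S\<close>, and every point of \<open>S\<close> has a predecessor in
      \<open>S\<close>.\<close>
    define A where "A = {\<phi>. cis \<phi> \<in> S \<and> cmod (w (cis \<phi>)) = \<rho>}"
    have \<tau>A: "\<tau> \<in> A" using True by (simp add: A_def \<rho>_def)
    have "cmod \<mu> \<noteq> \<rho>" using neg True by (auto simp: \<rho>_def)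
    then consider "cmod \<mu> < \<rho>" | "\<rho> < cmod \<mu>" by linarith
    then show False
    proof cases
      case 1
      have pre: "\<exists>\<phi>'\<in>A. Q (b \<phi>') c" if "\<phi> \<in> A" "Q \<phi> c" for \<phi> c
      proof -
        obtain y where y: "y \<in> S" "B y = cis \<phi>" using \<open>\<phi> \<in> A\<close> pred by (auto simp: A_def)
        obtain \<phi>' where \<phi>': "y = cis \<phi>'" using unit_circle_cis[OF sph[OF y(1)]] by blast
        then have "\<phi>' \<in> A" using inv(2)[OF y(1)] y \<open>\<phi> \<in> A\<close> by (auto simp: A_def)
        moreover have "Q (b \<phi>') c" using Q_cis[OF \<open>Q \<phi> c\<close>] y \<phi>' by (simp add: B_cis)
        ultimately show ?thesis by blast
      qed
      show False
      proof (cases "\<mu> = 0")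
        case True
        obtain \<phi>' where "\<phi>' \<in> A" "Q (b \<phi>') 1" using pre[OF \<tau>A Q\<tau>] by blast
        then show False using bwd0 True 1 by (fastforce simp: A_def)
      next
        case False
        show False
        proof (rule growth[where A = A and \<kappa> = "\<rho> / cmod \<mu>", OF _ _ \<tau>A _ Q\<tau>])
          fix \<phi> c assume "\<phi> \<in> A" "c > 0" "Q \<phi> c"
          then obtain \<phi>' where \<phi>': "\<phi>' \<in> A" "Q (b \<phi>') c" using pre by blast
          show "\<exists>\<phi>'\<in>A. \<exists>c'. \<rho> / cmod \<mu> * c \<le> c' \<and> Q \<phi>' c'"
            using bwd[OF \<phi>'(2) False] \<phi>'(1) by (intro bexI[OF _ \<phi>'(1)] exI[of _ "\<rho> * c / cmod \<mu>"]) (auto simp: A_def)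
        qed (use 1 False in auto)
      qed
    next
      case 2
      show False
      proof (cases "\<rho> = 0")
        case True
        then show False using fwd0[OF Q\<tau>] 2 by (simp add: \<rho>_def)
      next
        case False
        then have "\<rho> > 0" by (simp add: \<rho>_def)
        show False
        proof (rule growth[where A = A and \<kappa> = "cmod \<mu> / \<rho>", OF _ _ \<tau>A _ Q\<tau>])
          fix \<phi> c assume \<phi>: "\<phi> \<in> A" "c > 0" "Q \<phi> c"
          then have "b \<phi> \<in> A" using inv[of "cis \<phi>"] by (auto simp: A_def B_cis)
          moreover have "Q (b \<phi>) (cmod \<mu> * c / \<rho>)" using fwd[OF \<phi>(3)] \<phi>(1) \<open>\<rho> > 0\<close> by (auto simp: A_def)
          ultimately show "\<exists>\<phi>'\<in>A. \<exists>c'. cmod \<mu> / \<rho> * c \<le> c' \<and> Q \<phi>' c'"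
            by (intro bexI[of _ "b \<phi>"] exI[of _ "cmod \<mu> * c / \<rho>"]) auto
        qed (use 2 \<open>\<rho> > 0\<close> in auto)
      qed
    qed
  next
    case False
    \<comment> \<open>Adding full turns moves \<tau> to the right of \<open>p\<close>, where
      backward orbits under \<open>inv b\<close> converge to \<open>p\<close>.\<close>
    obtain n :: nat where n: "p - \<tau> < real n" using reals_Archimedean2 by blast
    define \<phi> where "\<phi> k = (inv b ^^ k) (\<tau> + 2 * pi * real n)" for k
    have c0: "cis (\<tau> + 2 * pi * real n) = cis \<tau>"
    proof -
      have "cis (2 * pi * real n) = 1" by (rule cis_multiple_2pi) simp
      then show ?thesis unfolding cis_mult[symmetric] by simp
    qed
    have "1 * real n \<le> (2 * pi) * real n" using pi_ge_two by (intro mult_right_mono) auto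
    then have "p < \<tau> + 2 * pi * real n" using n by linarith
    from backward_orbit(2)[OF p this] have \<phi>lim: "\<phi> \<longlonglongrightarrow> p" by (simp add: \<phi>_def[abs_def])
    have b\<phi>: "b (\<phi> (Suc k)) = \<phi> k" for k by (simp add: \<phi>_def b_inv)
    have out: "cis (\<phi> k) \<notin> S" for k
    proof (induction k)
      case 0
      then show ?case using False by (simp add: \<phi>_def c0)
    next
      case (Suc k)
      then show ?case using inv(1)[of "cis (\<phi> (Suc k))"] by (auto simp: B_cis b\<phi>)
    qed
    have nz: "w (cis (\<phi> (Suc k))) \<noteq> 0" for k
      using zeros[OF \<open>R > 0\<close>, of "cis (\<phi> (Suc k))"] out[of k] by (auto simp: B_cis b\<phi>)
    have Q0: "Q (\<phi> 0) 1" using Q_cis[OF Q\<tau>] c0 by (simp add: \<phi>_def)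
    show False
    proof (cases "\<mu> = 0")
      case True
      then show False using bwd0[of "\<phi> 1" 1] Q0 nz[of 0] b\<phi>[of 0] by simp
    next
      case False
      \<comment> \<open>As \<open>w\<close> has no zeros along the backward orbit, a positive limit
        survives the finitely many steps before the factors exceed 1.\<close>
      have ex: "\<exists>c>0. Q (\<phi> k) c" for k
      proof (induction k)
        case 0
        then show ?case using Q0 by (intro exI[of _ 1]) simp
      next
        case (Suc k)
        then obtain c where c: "c > 0" "Q (\<phi> k) c" by blast
        have "Q (\<phi> (Suc k)) (cmod (w (cis (\<phi> (Suc k)))) * c / cmod \<mu>)"
          using bwd[of "\<phi> (Suc k)" c] c False by (simp add: b\<phi>)
        moreover have "cmod (w (cis (\<phi> (Suc k)))) * c / cmod \<mu> > 0" using nz c False by simp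
        ultimately show ?case by blast
      qed
      \<comment> \<open>A value strictly between |\<mu>| and \<open>R\<close>: close to
        \<open>p\<close> the weight exceeds it, so each backward step gains at least the factor
        \<rho> / |\<mu>| > 1.\<close>
      define \<rho> where "\<rho> = (R + cmod \<mu>) / 2"
      have \<rho>: "cmod \<mu> < \<rho>" "\<rho> < R" using \<mu>R by (auto simp: \<rho>_def)
      have "\<forall>\<^sub>F k in sequentially. \<rho> < cmod (w (cis (\<phi> k)))"
        using \<rho> R(2) by (intro order_tendstoD(1)[OF wcont[OF \<phi>lim]]) simp
      then obtain K where K: "\<And>k. k \<ge> K \<Longrightarrow> \<rho> < cmod (w (cis (\<phi> k)))"
        by (auto simp: eventually_sequentially)
      obtain c where c: "c > 0" "Q (\<phi> K) c" using ex by blast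
      show False
      proof (rule growth[where A = "\<phi> ` {K..}" and \<kappa> = "\<rho> / cmod \<mu>", OF _ _ _ c])
        fix t c assume t: "t \<in> \<phi> ` {K..}" "c > 0" "Q t c"
        then obtain k where k: "k \<ge> K" "t = \<phi> k" by auto
        have "Q (\<phi> (Suc k)) (cmod (w (cis (\<phi> (Suc k)))) * c / cmod \<mu>)"
          using bwd[of "\<phi> (Suc k)" c] t k False by (simp add: b\<phi>)
        moreover have "\<rho> / cmod \<mu> * c \<le> cmod (w (cis (\<phi> (Suc k)))) * c / cmod \<mu>"
          using K[of "Suc k"] k t by (simp add: divide_right_mono mult_right_mono)
        ultimately show "\<exists>\<phi>'\<in>\<phi> ` {K..}. \<exists>c'. \<rho> / cmod \<mu> * c \<le> c' \<and> Q \<phi>' c'"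
          using k by (intro bexI[of _ "\<phi> (Suc k)"]) auto
      qed (use \<rho> False in auto)
    qed
  qed
qed

subsection \<open>Approximate eigenfunctions\<close>

text \<open>Peak functions at \<open>q\<close> composed with \<open>B\<close> concentrate near the
  fibre over \<open>q\<close>, where \<open>w\<close> is small. On the circle they converge
  pointwise to the indicator of \<open>q\<close>, which is discontinuous.\<close>

lemma usf_spectrum_zero:
  assumes w: "w \<in> disc_alg" and q: "cmod q = 1"
    and zero: "\<And>y. cmod y = 1 \<Longrightarrow> B y = q \<Longrightarrow> w y = 0"
  shows "0 \<in> usf_spectrum (\<lambda>f z. w z * f (B z))"
proof -
  define x where "x n z = ((1 + cnj q * z) / 2) ^ n" for n z
  have x: "x n \<in> disc_alg" for n unfolding x_def[abs_def] by (rule peak_power_disc_alg)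
  have x1: "cmod (x n z) \<le> 1" if "cmod z = 1" for n z unfolding x_def using that q by (rule peak_norm_le)
  have qq: "cnj q * q = 1" using q by (simp add: complex_norm_square[symmetric] mult.commute)
  then have xq: "x n q = 1" for n by (simp add: x_def)
  have norm1: "supnorm (x n) = 1" for n
    using supnorm_le[OF x x1] norm_le_supnorm[OF x, of q n] q xq by (intro antisym) auto
  define C where "C = supnorm w"
  have C: "cmod (w z) \<le> C" if "cmod z = 1" for z unfolding C_def using that by (intro norm_le_supnorm[OF w]) auto
  have C0: "C \<ge> 0" unfolding C_def by (rule supnorm_nonneg[OF w])
  have wcont: "continuous_on (sphere 0 1) (\<lambda>z. cmod (w z))"
    using w continuous_on_subset[of "cball 0 1" w "sphere 0 1"] by (intro continuous_on_norm) (auto simp: disc_alg_def)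
  have lim: "(\<lambda>n. supnorm (\<lambda>z. w z * x n (B z) - 0 * x n z)) \<longlonglongrightarrow> 0"
  proof (rule tendstoI)
    fix e :: real assume e: "e > 0"
    have "\<forall>\<^sub>F r in at_right 0. r > 0 \<and> (\<forall>y. cmod y = 1 \<and> dist (B y) q < r \<longrightarrow> cmod (w y) < e / 2)"
      using zero e by (intro eventually_conj eventually_near_fibre B_cont wcont) (auto simp: eventually_at_right_less)
    then obtain r where r: "r > 0" "\<And>y. cmod y = 1 \<Longrightarrow> dist (B y) q < r \<Longrightarrow> cmod (w y) < e / 2"
      using eventually_happens'[OF trivial_limit_at_right_real] by blast
    \<comment> \<open>\<open>C + 1\<close> in place of \<open>C\<close> keeps the denominator
      positive when \<open>C = 0\<close>.\<close>
    have "0 < e / (2 * (C + 1))" using e C0 by simp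
    from peak_power_small[OF r(1) this]
    show "\<forall>\<^sub>F n in sequentially. dist (supnorm (\<lambda>z. w z * x n (B z) - 0 * x n z)) 0 < e"
    proof eventually_elim
      case (elim n)
      have T: "(\<lambda>z. w z * x n (B z) - 0 * x n z) \<in> disc_alg"
        by (intro disc_alg_intros weighted_composition_disc_alg w x)
      have "supnorm (\<lambda>z. w z * x n (B z) - 0 * x n z) \<le> e / 2"
      proof (rule supnorm_le[OF T])
        fix z :: complex assume z: "cmod z = 1"
        show "cmod (w z * x n (B z) - 0 * x n z) \<le> e / 2"
        proof (cases "dist (B z) q < r")
          case True
          have "cmod (w z) * cmod (x n (B z)) \<le> e / 2 * 1"
            using r(2)[OF z True] x1[OF B_sphere[OF z], of n] e by (intro mult_mono) auto
          then show ?thesis by (simp add: norm_mult)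
        next
          case False
          then have "cmod (x n (B z)) \<le> e / (2 * (C + 1))"
            using elim B_sphere[OF z] q by (simp add: x_def dist_norm)
          then have "cmod (w z) * cmod (x n (B z)) \<le> (C + 1) * (e / (2 * (C + 1)))"
            using C[OF z] C0 by (intro mult_mono) auto
          also have "\<dots> = e / 2" using C0 by (simp add: field_simps)
          finally show ?thesis by (simp add: norm_mult)
        qed
      qed
      with supnorm_nonneg[OF T] e show ?case by (simp add: dist_real_def)
    qed
  qed
  have "\<not> (\<exists>r g. strict_mono r \<and> g \<in> disc_alg \<and> (\<lambda>n. supnorm (\<lambda>z. x (r n) z - g z)) \<longlonglongrightarrow> 0)"
  proof safe
    fix r :: "nat \<Rightarrow> nat" and g
    assume r: "strict_mono r" and g: "g \<in> disc_alg" and lim: "(\<lambda>n. supnorm (\<lambda>z. x (r n) z - g z)) \<longlonglongrightarrow> 0"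
    have pt: "(\<lambda>n. x (r n) z) \<longlonglongrightarrow> g z" if "cmod z \<le> 1" for z
      using that by (intro supnorm_limit_pointwise x g lim)
    have "g q = 1" using pt[of q] q xq by (simp add: LIMSEQ_const_iff)
    have g0: "g z = 0" if z: "cmod z = 1" "z \<noteq> q" for z
    proof -
      have "(\<lambda>n. x n z) \<longlonglongrightarrow> 0"
      proof (rule tendstoI)
        fix e :: real assume e: "e > 0"
        have "0 < e / 2" "0 < cmod (z - q)" using e z by auto
        from peak_power_small[OF this(2,1)]
        show "\<forall>\<^sub>F n in sequentially. dist (x n z) 0 < e"
        proof eventually_elim
          case (elim n)
          then have "cmod (x n z) \<le> e / 2" using z q by (simp add: x_def)
          then show ?case using e by simp
        qed
      qed
      from LIMSEQ_subseq_LIMSEQ[OF this r] pt[of z] z show ?thesis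
        using LIMSEQ_unique by (fastforce simp: o_def)
    qed
    obtain t where t: "q = cis t" using unit_circle_cis[OF q] by blast
    have "continuous_on UNIV (\<lambda>t. g (cis t))"
      using g by (intro continuous_on_compose2[of "cball 0 1" g UNIV cis] continuous_intros) (auto simp: disc_alg_def)
    \<comment> \<open>Points of the circle other than \<open>q\<close> that tend to
      \<open>q\<close>; \<open>g\<close> vanishes at all of them.\<close>
    moreover have "(\<lambda>n. t + inverse (real (Suc n))) \<longlonglongrightarrow> t + 0"
      by (intro tendsto_intros LIMSEQ_inverse_real_of_nat)
    ultimately have "(\<lambda>n. g (cis (t + inverse (real (Suc n))))) \<longlonglongrightarrow> g (cis t)"
      using continuous_on_tendsto_compose[of UNIV "\<lambda>t. g (cis t)"] by fastforce
    moreover have "g (cis (t + inverse (real (Suc n)))) = 0" for n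
    proof (rule g0)
      show "cis (t + inverse (real (Suc n))) \<noteq> q"
      proof
        have "inverse (real (Suc n)) \<le> 1" by (simp add: field_simps)
        assume "cis (t + inverse (real (Suc n))) = q"
        then have "t + inverse (real (Suc n)) = t"
          unfolding t using \<open>inverse (real (Suc n)) \<le> 1\<close> pi_ge_two by (intro cis_eq_imp_eq) auto
        then show False by simp
      qed
    qed simp
    ultimately have "g q = 0" by (simp add: LIMSEQ_const_iff t)
    with \<open>g q = 1\<close> show False by simp
  qed
  then show ?thesis
    unfolding usf_spectrum_def using x norm1 lim by blast
qed

text \<open>The weight of the \<open>k\<close>-th power of the operator: T^k g is the function z
  \<mapsto> \<open>wprod w k z * g ((B ^^ k) z)\<close>.\<close>

definition wprod :: "(complex \<Rightarrow> complex) \<Rightarrow> nat \<Rightarrow> complex \<Rightarrow> complex" where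
  "wprod w k y = (\<Prod>i<k. w ((B ^^ i) y))"

lemma wprod_Suc: "wprod w (Suc k) y = w y * wprod w k (B y)"
  unfolding wprod_def by (subst prod.lessThan_Suc_shift) (simp add: funpow_swap1)

lemma wprod_disc_alg:
  assumes "w \<in> disc_alg" "g \<in> disc_alg"
  shows "(\<lambda>z. wprod w k z * g ((B ^^ k) z)) \<in> disc_alg"
proof (induction k)
  case 0
  then show ?case using assms by (simp add: wprod_def)
next
  case (Suc k)
  have "(\<lambda>z. wprod w (Suc k) z * g ((B ^^ Suc k) z)) = (\<lambda>z. w z * (\<lambda>z. wprod w k z * g ((B ^^ k) z)) (B z))"
    by (auto simp: wprod_Suc funpow_swap1 mult.assoc)
  then show ?case using weighted_composition_disc_alg[OF assms(1) Suc] by simp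
qed

lemma wprod_cont:
  assumes "w \<in> disc_alg"
  shows "continuous_on (sphere 0 1) (wprod w k)"
proof -
  have "continuous_on (cball 0 1) (wprod w k)"
    using wprod_disc_alg[OF assms disc_alg_intros(1)[of 1], of k] by (simp add: disc_alg_def)
  then show ?thesis by (rule continuous_on_subset) auto
qed

text \<open>\<open>f\<close> is large at a point near \<open>q\<close> and tiny at \<open>q\<close>
  itself; this steepness will rule out convergent subsequences. By \<open>tree\<close> the weight
  normalised by \<rho>^k is at most 1 along every branch that ends in the orbit.\<close>

lemma approximate_eigenfunction:
  assumes w: "w \<in> disc_alg" and q: "periodic q" and \<rho>: "\<rho> > 0" "cmod \<mu> = \<rho>"
    and orb: "\<And>x. x \<in> orb q \<Longrightarrow> cmod (w x) = \<rho>"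
    and tree: "\<And>k y. cmod y = 1 \<Longrightarrow> (B ^^ k) y \<in> orb q \<Longrightarrow> cmod (wprod w k y) \<le> \<rho> ^ k"
    and n: "n > 0" and \<epsilon>: "\<epsilon> > 0"
  shows "\<exists>f s. f \<in> disc_alg \<and> cmod s = 1 \<and> dist s q < \<epsilon> \<and> 1/2 \<le> cmod (f s) \<and> cmod (f q) \<le> \<epsilon>
    \<and> (\<forall>z. cmod z = 1 \<longrightarrow> cmod (f z) \<le> 2)
    \<and> (\<forall>z. cmod z = 1 \<longrightarrow> cmod (w z * f (B z) - \<mu> * f z) \<le> 2 * \<rho> / real n)"
proof -
  \<comment> \<open>With e \<le> 1/4 the main term at \<open>s\<close> minus the rest is at least 1
    - 2e \<ge> 1/2, and the sum of all terms is at most 1 + 2e \<le> 2.\<close>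
  define e where "e = min \<epsilon> (1/4)"
  have e: "e > 0" "e \<le> \<epsilon>" "e \<le> 1/4" using \<epsilon> by (auto simp: e_def)
  have q1: "cmod q = 1" using q by (simp add: periodic_def)
  have \<mu>0: "\<mu> \<noteq> 0" using \<rho> by auto
  \<comment> \<open>\<open>g\<close> will peak near \<open>qn\<close>, so that the term k = n, where
    the tent has its top, is large near \<open>q\<close>.\<close>
  define qn where "qn = (B ^^ n) q"
  have qn: "qn \<in> orb q" by (simp add: qn_def orb_def)
  define W where "W k y = cmod (wprod w k y) / \<rho> ^ k" for k y
  have W0: "W k y \<ge> 0" for k y using \<rho> by (simp add: W_def)
  have Wcont: "continuous_on (sphere 0 1) (W k)" for k
    unfolding W_def using \<rho> wprod_cont[OF w] by (intro continuous_intros) auto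
  have Wq: "W n q = 1"
  proof -
    have "cmod (wprod w n q) = (\<Prod>i<n. \<rho>)"
      unfolding wprod_def prod_norm[symmetric] by (intro prod.cong orb) (auto simp: orb_def)
    then show ?thesis using \<rho> by (simp add: W_def)
  qed
  \<comment> \<open>On the fibres over \<open>qn\<close> the bound is 1 by \<open>tree\<close>;
    compactness extends it, with loss \<open>e\<close>, to the preimages of an \<open>r\<close>-ball
    under the iterates up to 2n.\<close>
  have "\<forall>\<^sub>F r in at_right 0. \<forall>k\<in>{..2*n}. \<forall>y. cmod y = 1 \<and> dist ((B ^^ k) y) qn < r \<longrightarrow> W k y < 1 + e"
  proof (intro eventually_ball_finite ballI eventually_near_fibre iter_cont Wcont)
    fix k y assume "cmod y = 1" "(B ^^ k) y = qn"
    then have "W k y \<le> 1" using tree[of y k] qn \<rho> by (simp add: W_def)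
    with e show "W k y < 1 + e" by simp
  qed simp
  then have "\<forall>\<^sub>F r in at_right 0. r > 0 \<and> (\<forall>k\<in>{..2*n}. \<forall>y. cmod y = 1 \<and> dist ((B ^^ k) y) qn < r \<longrightarrow> W k y < 1 + e)"
    by (intro eventually_conj) (auto simp: eventually_at_right_less)
  from eventually_happens'[OF trivial_limit_at_right_real this]
  obtain r where r: "r > 0" "\<And>k y. k \<le> 2 * n \<Longrightarrow> cmod y = 1 \<Longrightarrow> dist ((B ^^ k) y) qn < r \<Longrightarrow> W k y < 1 + e"
    by auto
  \<comment> \<open>Lower bounds near a point come from \<open>eventually_near_fibre\<close> for
    negated functions, with the identity as \<open>h\<close>.\<close>
  have "\<forall>\<^sub>F \<delta> in at_right 0. \<forall>y. cmod y = 1 \<and> dist y q < \<delta> \<longrightarrow> - W n y < - (1 - e)"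
    using Wq e by (intro eventually_near_fibre continuous_intros Wcont) auto
  moreover have "\<forall>\<^sub>F \<delta> in at_right 0. \<forall>y. cmod y = 1 \<and> dist y q < \<delta> \<longrightarrow> dist ((B ^^ n) y) qn < r"
    using r by (intro eventually_near_fibre continuous_intros iter_cont) (auto simp: qn_def)
  moreover have "\<forall>\<^sub>F \<delta> in at_right 0. \<delta> > 0 \<and> \<delta> \<le> \<epsilon>"
    using \<epsilon> by (intro eventually_conj eventually_at_right_le) (auto simp: eventually_at_right_less)
  ultimately have "\<forall>\<^sub>F \<delta> in at_right 0. (\<delta> > 0 \<and> \<delta> \<le> \<epsilon>) \<and>
      (\<forall>y. cmod y = 1 \<and> dist y q < \<delta> \<longrightarrow> 1 - e < W n y \<and> dist ((B ^^ n) y) qn < r)"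
    by eventually_elim auto
  from eventually_happens'[OF trivial_limit_at_right_real this]
  obtain \<delta> where \<delta>: "\<delta> > 0" "\<delta> \<le> \<epsilon>"
      "\<And>y. cmod y = 1 \<Longrightarrow> dist y q < \<delta> \<Longrightarrow> 1 - e < W n y \<and> dist ((B ^^ n) y) qn < r"
    by auto
  \<comment> \<open>The preperiodic points of the circle, a countable union of finite sets; a point
    outside \<open>C\<close> never repeats along its orbit.\<close>
  define C where "C = (\<Union>i. \<Union>k\<in>{i<..}. {z. cmod z = 1 \<and> (B ^^ i) z = (B ^^ k) z})"
  have "countable C" unfolding C_def
    using finite_coincidence by (intro countable_UN) (auto intro: countable_finite)
  then obtain s where s: "cmod s = 1" "dist s q < \<delta>" "s \<notin> C"
    using uncountable_arc[OF q1 \<delta>(1)] by blast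
  have sne: "(B ^^ i) s \<noteq> (B ^^ k) s" if "i < k" for i k using s(1,3) that by (auto simp: C_def)
  define v where "v = (B ^^ n) s"
  have v1: "cmod v = 1" unfolding v_def using s by (intro iter_sphere)
  have v_iter: "(B ^^ j) v \<noteq> v" if "j > 0" for j
    using sne[of n "j + n"] that by (auto simp: v_def funpow_add)
  \<comment> \<open>Otherwise \<open>v\<close> would itself be periodic.\<close>
  have v_orb: "(B ^^ k) q \<noteq> v" for k
  proof
    assume k: "(B ^^ k) q = v"
    obtain N where N: "N > 0" "(B ^^ N) q = q" using q by (auto simp: periodic_def)
    have "(B ^^ N) v = (B ^^ k) ((B ^^ N) q)"
      unfolding k[symmetric] by (metis add.commute comp_apply funpow_add)
    then show False using v_iter[OF N(1)] N(2) k by simp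
  qed
  \<comment> \<open>The radius \<open>r'\<close> is to be so small that the \<open>r'\<close>-ball
    about \<open>v\<close> lies in the \<open>r\<close>-ball about \<open>qn\<close>, misses the
    iterates of \<open>q\<close> up to 2n, and no circle point of it returns within 2n
    steps.\<close>
  have "\<forall>\<^sub>F r' in at_right 0. \<forall>j\<in>{1..2*n}. \<forall>y. cmod y = 1 \<and> dist y v < r' \<longrightarrow> - dist ((B ^^ j) y) v < - (dist ((B ^^ j) v) v / 2)"
    using v_iter by (intro eventually_ball_finite ballI eventually_near_fibre continuous_intros iter_cont) auto
  moreover have "\<forall>\<^sub>F r' in at_right 0. \<forall>j\<in>{1..2*n}. r' \<le> dist ((B ^^ j) v) v / 2"
    using v_iter by (intro eventually_ball_finite ballI eventually_at_right_le) auto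
  moreover have "\<forall>\<^sub>F r' in at_right 0. \<forall>k\<in>{..2*n}. r' \<le> dist ((B ^^ k) q) v"
    using v_orb by (intro eventually_ball_finite ballI eventually_at_right_le) auto
  moreover have "\<forall>\<^sub>F r' in at_right 0. r' \<le> r - dist v qn"
    using \<delta>(3)[OF s(1,2)] by (intro eventually_at_right_le) (simp add: v_def)
  moreover have "\<forall>\<^sub>F r' in at_right 0. (0::real) < r'" by (simp add: eventually_at_right_less)
  ultimately have "\<forall>\<^sub>F r' in at_right 0. 0 < r' \<and> r' \<le> r - dist v qn \<and> (\<forall>k\<in>{..2*n}. r' \<le> dist ((B ^^ k) q) v)
      \<and> (\<forall>j\<in>{1..2*n}. \<forall>y. cmod y = 1 \<and> dist y v < r' \<longrightarrow> r' < dist ((B ^^ j) y) v)"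
    by eventually_elim (auto, smt (verit) atLeastAtMost_iff One_nat_def)
  from eventually_happens'[OF trivial_limit_at_right_real this]
  obtain r' where r': "r' > 0" "r' \<le> r - dist v qn" "\<And>k. k \<le> 2 * n \<Longrightarrow> r' \<le> dist ((B ^^ k) q) v"
     "\<And>j y. 1 \<le> j \<Longrightarrow> j \<le> 2 * n \<Longrightarrow> cmod y = 1 \<Longrightarrow> dist y v < r' \<Longrightarrow> r' < dist ((B ^^ j) y) v"
    by auto
  define D where "D = supnorm w"
  have D: "cmod (w z) \<le> D" if "cmod z = 1" for z unfolding D_def using that by (intro norm_le_supnorm[OF w]) auto
  have D0: "D \<ge> 0" unfolding D_def by (rule supnorm_nonneg[OF w])
  have WD: "W k y \<le> D ^ k / \<rho> ^ k" if "cmod y = 1" for k y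
  proof -
    have "cmod (wprod w k y) \<le> (\<Prod>i<k. D)"
      unfolding wprod_def prod_norm[symmetric] using that by (intro prod_mono conjI D iter_sphere) auto
    then show ?thesis using \<rho> by (simp add: W_def divide_right_mono)
  qed
  \<comment> \<open>A crude bound for the sum of all normalised weights; with \<open>A + 1\<close>
    in the denominator of \<eta>, the terms away from the peak add up to at most
    \<open>e\<close>.\<close>
  define A where "A = (\<Sum>k\<le>2*n. D ^ k / \<rho> ^ k)"
  have A0: "A \<ge> 0" unfolding A_def using D0 \<rho> by (intro sum_nonneg) auto
  define \<eta> where "\<eta> = e / (A + 1)"
  have \<eta>: "\<eta> > 0" "A * \<eta> \<le> e" using e A0 by (auto simp: \<eta>_def field_simps)
  obtain N where N: "\<And>z. cmod z = 1 \<Longrightarrow> r' \<le> cmod (z - v) \<Longrightarrow> cmod (((1 + cnj v * z) / 2) ^ N) \<le> \<eta>"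
    using eventually_happens'[OF sequentially_bot peak_power_small[OF r'(1) \<eta>(1)]] v1 by blast
  define g where "g z = ((1 + cnj v * z) / 2) ^ N" for z
  have g: "g \<in> disc_alg" unfolding g_def[abs_def] by (rule peak_power_disc_alg)
  have g1: "cmod (g z) \<le> 1" if "cmod z = 1" for z unfolding g_def using that v1 by (rule peak_norm_le)
  have gv: "g v = 1" using v1 by (simp add: g_def complex_norm_square[symmetric] mult.commute)
  have g\<eta>: "cmod (g z) \<le> \<eta>" if "cmod z = 1" "\<not> dist z v < r'" for z
    unfolding g_def using that by (intro N) (auto simp: dist_norm)
  define H where "H k z = wprod w k z * g ((B ^^ k) z)" for k z
  have H: "H k \<in> disc_alg" for k unfolding H_def[abs_def] by (rule wprod_disc_alg[OF w g])
  have HSuc: "w z * H k (B z) = H (Suc k) z" for k z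
    by (simp add: H_def wprod_Suc funpow_swap1)
  define h where "h k z = H k z / \<mu> ^ k" for k z
  have h_norm: "cmod (h k z) = W k z * cmod (g ((B ^^ k) z))" for k z
    using \<rho> by (simp add: h_def H_def W_def norm_mult norm_divide norm_power)
  have h_far: "cmod (h k z) \<le> D ^ k / \<rho> ^ k * \<eta>" if "cmod z = 1" "\<not> dist ((B ^^ k) z) v < r'" for k z
    unfolding h_norm using WD[OF that(1)] g\<eta>[OF iter_sphere[OF that(1)] that(2)] W0 D0 \<rho>
    by (intro mult_mono) auto
  have h_near: "cmod (h k z) \<le> 1 + e" if "cmod z = 1" "dist ((B ^^ k) z) v < r'" "k \<le> 2 * n" for k z
  proof -
    have "dist ((B ^^ k) z) qn < r" using that(2) r'(2) dist_triangle[of "(B ^^ k) z" qn v] by linarith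
    then have "W k z \<le> 1 + e" using r(2)[OF that(3,1)] by simp
    then have "W k z * cmod (g ((B ^^ k) z)) \<le> (1 + e) * 1"
      using g1[OF iter_sphere[OF that(1)]] e by (intro mult_mono) auto
    then show ?thesis by (simp add: h_norm)
  qed
  \<comment> \<open>Since nothing returns to the ball within 2n steps, at each \<open>z\<close> at
    most one index gives a large term.\<close>
  have unique: "i = k" if z: "cmod z = 1" "dist ((B ^^ i) z) v < r'" "dist ((B ^^ k) z) v < r'" "i \<le> 2 * n" "k \<le> 2 * n" for i k z
  proof -
    have False if "i < k" "k \<le> 2 * n" "dist ((B ^^ i) z) v < r'" "dist ((B ^^ k) z) v < r'" for i k
    proof -
      have "(B ^^ k) z = (B ^^ (k - i)) ((B ^^ i) z)"
        using that(1) by (metis comp_apply funpow_add le_add_diff_inverse2 less_imp_le)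
      moreover have "r' < dist ((B ^^ (k - i)) ((B ^^ i) z)) v"
        using that z(1) by (intro r'(4) iter_sphere) auto
      ultimately show False using that by simp
    qed
    with z show ?thesis by (metis nat_neq_iff)
  qed
  have far_sum: "(\<Sum>k\<in>I. cmod (h k z)) \<le> e"
    if "cmod z = 1" "I \<subseteq> {..2*n}" "\<And>k. k \<in> I \<Longrightarrow> \<not> dist ((B ^^ k) z) v < r'" for I z
  proof -
    have "(\<Sum>k\<in>I. cmod (h k z)) \<le> (\<Sum>k\<in>I. D ^ k / \<rho> ^ k * \<eta>)"
      using that by (intro sum_mono h_far) auto
    also have "\<dots> \<le> (\<Sum>k\<le>2*n. D ^ k / \<rho> ^ k * \<eta>)"
      using that(2) D0 \<rho> \<eta> by (intro sum_mono2) auto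
    also have "\<dots> = A * \<eta>" by (simp add: A_def sum_distrib_right)
    finally show ?thesis using \<eta> by simp
  qed
  have total: "(\<Sum>k\<le>2*n. cmod (h k z)) \<le> 2" if z: "cmod z = 1" for z
  proof (cases "\<exists>k\<le>2*n. dist ((B ^^ k) z) v < r'")
    case True
    then obtain k where k: "k \<le> 2 * n" "dist ((B ^^ k) z) v < r'" by blast
    have "(\<Sum>k\<le>2*n. cmod (h k z)) = cmod (h k z) + (\<Sum>i\<in>{..2*n} - {k}. cmod (h i z))"
      using k by (intro sum.remove) auto
    also have "\<dots> \<le> (1 + e) + e"
      using unique[OF z _ k(2) _ k(1)] by (intro add_mono h_near[OF z k(2,1)] far_sum z) auto
    finally show ?thesis using e by simp
  next
    case False
    then have "(\<Sum>k\<le>2*n. cmod (h k z)) \<le> e" by (intro far_sum z) auto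
    then show ?thesis using e by simp
  qed
  \<comment> \<open>A tent with top 1 at \<open>n\<close> and slope 1/n; it vanishes at both ends,
    so the telescoping leaves no boundary terms.\<close>
  define c where "c k = max 0 (1 - \<bar>real k - real n\<bar> / real n)" for k :: nat
  have c: "c 0 = 0" "c n = 1" "c (2 * n) = 0" "\<And>k. 0 \<le> c k" "\<And>k. c k \<le> 1" using n by (auto simp: c_def)
  have c_diff: "\<bar>c k - c (Suc k)\<bar> \<le> 1 / real n" for k
  proof -
    have "\<bar>\<bar>real k - real n\<bar> / real n - \<bar>real (Suc k) - real n\<bar> / real n\<bar> = \<bar>\<bar>real k - real n\<bar> - \<bar>real (Suc k) - real n\<bar>\<bar> / real n"
      by (simp add: diff_divide_distrib[symmetric])
    also have "\<dots> \<le> 1 / real n" by (intro divide_right_mono) auto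
    finally show ?thesis unfolding c_def by linarith
  qed
  define f where "f z = (\<Sum>k\<le>2*n. of_real (c k) * h k z)" for z
  have f: "f \<in> disc_alg"
  proof -
    have "f = (\<lambda>z. \<Sum>k\<le>2*n. of_real (c k) / \<mu> ^ k * H k z)" by (simp add: fun_eq_iff f_def h_def)
    also have "\<dots> \<in> disc_alg" by (intro disc_alg_intros H)
    finally show ?thesis .
  qed
  show ?thesis
  proof (intro exI[of _ f] exI[of _ s] conjI allI impI f s(1))
    show "dist s q < \<epsilon>" using s \<delta> by simp
  next
    have "f s = of_real (c n) * h n s + (\<Sum>k\<in>{..2*n} - {n}. of_real (c k) * h k s)"
      unfolding f_def by (intro sum.remove) auto
    moreover have "cmod (\<Sum>k\<in>{..2*n} - {n}. of_real (c k) * h k s) \<le> e"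
    proof -
      have "cmod (\<Sum>k\<in>{..2*n} - {n}. of_real (c k) * h k s) \<le> (\<Sum>k\<in>{..2*n} - {n}. cmod (h k s))"
        using c by (intro sum_norm_le) (simp add: norm_mult mult_left_le_one_le)
      also have "\<dots> \<le> e"
        using unique[OF s(1), of _ n] r'(1) by (intro far_sum s) (auto simp: v_def)
      finally show ?thesis .
    qed
    moreover have "cmod (h n s) > 1 - e"
      using \<delta>(3)[OF s(1,2)] gv by (simp add: h_norm v_def)
    ultimately show "1/2 \<le> cmod (f s)"
      using norm_triangle_ineq2[of "h n s" "- (\<Sum>k\<in>{..2*n} - {n}. of_real (c k) * h k s)"] e c by simp
  next
    have "cmod (f q) \<le> (\<Sum>k\<le>2*n. cmod (h k q))"
      unfolding f_def using c by (intro sum_norm_le) (simp add: norm_mult mult_left_le_one_le)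
    also have "\<dots> \<le> e" using r'(3) q1 by (intro far_sum) (auto simp: not_less)
    finally show "cmod (f q) \<le> \<epsilon>" using e by simp
  next
    fix z :: complex assume z: "cmod z = 1"
    have "cmod (f z) \<le> (\<Sum>k\<le>2*n. cmod (h k z))"
      unfolding f_def using c by (intro sum_norm_le) (simp add: norm_mult mult_left_le_one_le)
    with total[OF z] show "cmod (f z) \<le> 2" by simp
  next
    fix z :: complex assume z: "cmod z = 1"
    \<comment> \<open>T maps \<open>h k\<close> to \<mu> times \<open>h (Suc k)\<close>, so T -
      \<mu> acts on the sum by taking differences of neighbouring coefficients, each of size at most
      1/n.\<close>
    have hS: "w z * h k (B z) = \<mu> * h (Suc k) z" for k
      using \<mu>0 HSuc[of z k] by (simp add: h_def)
    have n2: "{..2*n} = insert (2 * n) {..<2*n}" by auto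
    have "w z * f (B z) = (\<Sum>k\<le>2*n. of_real (c k) * (\<mu> * h (Suc k) z))"
      unfolding f_def hS[symmetric] by (simp add: sum_distrib_left mult.left_commute)
    also have "\<dots> = (\<Sum>k<2*n. of_real (c k) * (\<mu> * h (Suc k) z))"
      unfolding n2 using c(3) by simp
    finally have 1: "w z * f (B z) = (\<Sum>k<2*n. of_real (c k) * (\<mu> * h (Suc k) z))" .
    have "f z = of_real (c 0) * h 0 z + (\<Sum>k<2*n. of_real (c (Suc k)) * h (Suc k) z)"
      unfolding f_def by (rule sum.atMost_shift)
    then have 2: "\<mu> * f z = (\<Sum>k<2*n. of_real (c (Suc k)) * (\<mu> * h (Suc k) z))"
      using c(1) by (simp add: sum_distrib_left mult.left_commute)
    have "w z * f (B z) - \<mu> * f z = (\<Sum>k<2*n. of_real (c k - c (Suc k)) * (\<mu> * h (Suc k) z))"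
      unfolding 1 2 by (simp add: sum_subtractf[symmetric] left_diff_distrib)
    also have "cmod \<dots> \<le> (\<Sum>k<2*n. 1 / real n * (\<rho> * cmod (h (Suc k) z)))"
    proof (rule sum_norm_le)
      fix k
      have "cmod (of_real (c k - c (Suc k)) * (\<mu> * h (Suc k) z)) = \<bar>c k - c (Suc k)\<bar> * (\<rho> * cmod (h (Suc k) z))"
        by (simp only: norm_mult norm_of_real \<rho>(2))
      also have "\<dots> \<le> 1 / real n * (\<rho> * cmod (h (Suc k) z))"
        using \<rho>(1) by (intro mult_right_mono c_diff) simp
      finally show "cmod (of_real (c k - c (Suc k)) * (\<mu> * h (Suc k) z)) \<le> 1 / real n * (\<rho> * cmod (h (Suc k) z))" .
    qed
    also have "\<dots> = 1 / real n * \<rho> * (\<Sum>k<2*n. cmod (h (Suc k) z))"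
      by (simp add: sum_distrib_left mult.assoc)
    also have "(\<Sum>k<2*n. cmod (h (Suc k) z)) \<le> (\<Sum>k\<le>2*n. cmod (h k z))"
      unfolding sum.atMost_shift by simp
    also have "\<dots> \<le> 2" by (rule total[OF z])
    finally show "cmod (w z * f (B z) - \<mu> * f z) \<le> 2 * \<rho> / real n"
      using \<rho>(1) by (simp add: mult_left_mono divide_right_mono mult.commute)
  qed
qed

text \<open>After normalisation the approximate eigenfunctions tend to 0 at \<open>q\<close> but
  keep modulus at least 1/4 at points tending to \<open>q\<close>, so no subsequence has a
  continuous uniform limit.\<close>

lemma usf_spectrum_periodic:
  assumes w: "w \<in> disc_alg" and q: "periodic q" and \<rho>: "\<rho> > 0" "cmod \<mu> = \<rho>"
    and orb: "\<And>x. x \<in> orb q \<Longrightarrow> cmod (w x) = \<rho>"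
    and tree: "\<And>k y. cmod y = 1 \<Longrightarrow> (B ^^ k) y \<in> orb q \<Longrightarrow> cmod (wprod w k y) \<le> \<rho> ^ k"
  shows "\<mu> \<in> usf_spectrum (\<lambda>f z. w z * f (B z))"
proof -
  have q1: "cmod q = 1" using q by (simp add: periodic_def)
  have "\<forall>n. \<exists>f s. f \<in> disc_alg \<and> cmod s = 1 \<and> dist s q < inverse (real (Suc n)) \<and> 1/2 \<le> cmod (f s)
    \<and> cmod (f q) \<le> inverse (real (Suc n)) \<and> (\<forall>z. cmod z = 1 \<longrightarrow> cmod (f z) \<le> 2)
    \<and> (\<forall>z. cmod z = 1 \<longrightarrow> cmod (w z * f (B z) - \<mu> * f z) \<le> 2 * \<rho> / real (Suc n))"
    by (intro allI approximate_eigenfunction assms) auto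
  then obtain f s where fs: "\<forall>n. f n \<in> disc_alg \<and> cmod (s n) = 1 \<and> dist (s n) q < inverse (real (Suc n)) \<and> 1/2 \<le> cmod (f n (s n))
    \<and> cmod (f n q) \<le> inverse (real (Suc n)) \<and> (\<forall>z. cmod z = 1 \<longrightarrow> cmod (f n z) \<le> 2)
    \<and> (\<forall>z. cmod z = 1 \<longrightarrow> cmod (w z * f n (B z) - \<mu> * f n z) \<le> 2 * \<rho> / real (Suc n))" by metis
  have f: "f n \<in> disc_alg" and s: "cmod (s n) = 1" "dist (s n) q < inverse (real (Suc n))" "1/2 \<le> cmod (f n (s n))"
    and fq: "cmod (f n q) \<le> inverse (real (Suc n))"
    and f2: "cmod z = 1 \<Longrightarrow> cmod (f n z) \<le> 2"
    and ap: "cmod z = 1 \<Longrightarrow> cmod (w z * f n (B z) - \<mu> * f n z) \<le> 2 * \<rho> / real (Suc n)" for n z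
    using fs by auto
  define N where "N n = supnorm (f n)" for n
  have N: "1/2 \<le> N n" for n using s(3)[of n] norm_le_supnorm[OF f, of "s n" n] s(1)[of n] by (simp add: N_def)
  then have Npos: "N n > 0" for n by (smt (verit) half_gt_zero zero_less_one)
  have N2: "N n \<le> 2" for n unfolding N_def by (rule supnorm_le[OF f f2])
  have invN: "inverse (N n) \<le> 2" for n using N[of n] Npos[of n] by (simp add: field_simps)
  define x where "x n z = of_real (inverse (N n)) * f n z" for n z
  have x: "x n \<in> disc_alg" for n unfolding x_def[abs_def] by (intro disc_alg_intros f)
  have x1: "supnorm (x n) = 1" for n
    unfolding x_def[abs_def] using supnorm_cmult[OF f, of "of_real (inverse (N n))" n] Npos[of n]
    by (simp add: N_def norm_inverse)
  have lim: "(\<lambda>n. supnorm (\<lambda>z. w z * x n (B z) - \<mu> * x n z)) \<longlonglongrightarrow> 0"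
  proof (rule Lim_null_comparison)
    have T: "(\<lambda>z. w z * x n (B z) - \<mu> * x n z) \<in> disc_alg" for n
      by (intro disc_alg_intros weighted_composition_disc_alg w x)
    have "supnorm (\<lambda>z. w z * x n (B z) - \<mu> * x n z) \<le> 4 * \<rho> * inverse (real (Suc n))" for n
    proof (rule supnorm_le[OF T])
      fix z :: complex assume z: "cmod z = 1"
      have "w z * x n (B z) - \<mu> * x n z = of_real (inverse (N n)) * (w z * f n (B z) - \<mu> * f n z)"
        by (simp add: x_def algebra_simps)
      then have "cmod (w z * x n (B z) - \<mu> * x n z) = inverse (N n) * cmod (w z * f n (B z) - \<mu> * f n z)"
        using Npos[of n] by (simp only: norm_mult norm_of_real) simp
      also have "\<dots> \<le> 2 * (2 * \<rho> / real (Suc n))"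
        using ap[OF z] invN by (intro mult_mono) auto
      finally show "cmod (w z * x n (B z) - \<mu> * x n z) \<le> 4 * \<rho> * inverse (real (Suc n))"
        by (simp add: divide_inverse)
    qed
    with supnorm_nonneg[OF T] show "\<forall>\<^sub>F n in sequentially. norm (supnorm (\<lambda>z. w z * x n (B z) - \<mu> * x n z)) \<le> 4 * \<rho> * inverse (real (Suc n))"
      by (intro always_eventually) simp
    show "(\<lambda>n. 4 * \<rho> * inverse (real (Suc n))) \<longlonglongrightarrow> 0"
      by (intro tendsto_mult_right_zero LIMSEQ_inverse_real_of_nat)
  qed
  have "\<not> (\<exists>r g. strict_mono r \<and> g \<in> disc_alg \<and> (\<lambda>n. supnorm (\<lambda>z. x (r n) z - g z)) \<longlonglongrightarrow> 0)"
  proof safe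
    fix r :: "nat \<Rightarrow> nat" and g
    assume r: "strict_mono r" and g: "g \<in> disc_alg" and lim: "(\<lambda>n. supnorm (\<lambda>z. x (r n) z - g z)) \<longlonglongrightarrow> 0"
    have inv0: "(\<lambda>n. inverse (real (Suc (r n)))) \<longlonglongrightarrow> 0"
      using LIMSEQ_subseq_LIMSEQ[OF LIMSEQ_inverse_real_of_nat r] by (simp add: o_def)
    have "(\<lambda>n. x (r n) q) \<longlonglongrightarrow> g q" using q1 by (intro supnorm_limit_pointwise x g lim) auto
    moreover have "(\<lambda>n. x (r n) q) \<longlonglongrightarrow> 0"
    proof (rule Lim_null_comparison)
      have "cmod (x n q) \<le> 2 * inverse (real (Suc n))" for n
      proof -
        have "cmod (x n q) = inverse (N n) * cmod (f n q)" using Npos[of n] by (simp add: x_def norm_mult norm_inverse)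
        also have "\<dots> \<le> 2 * inverse (real (Suc n))" using fq invN by (intro mult_mono) auto
        finally show ?thesis .
      qed
      then show "\<forall>\<^sub>F n in sequentially. cmod (x (r n) q) \<le> 2 * inverse (real (Suc (r n)))" by (intro always_eventually) simp
      show "(\<lambda>n. 2 * inverse (real (Suc (r n)))) \<longlonglongrightarrow> 0" by (intro tendsto_mult_right_zero inv0)
    qed
    ultimately have gq: "g q = 0" using LIMSEQ_unique by blast
    have "(\<lambda>n. dist (s (r n)) q) \<longlonglongrightarrow> 0"
      using s(2) less_imp_le by (intro Lim_null_comparison[OF _ inv0] always_eventually) auto
    then have "(\<lambda>n. s (r n)) \<longlonglongrightarrow> q" by (rule tendsto_dist_iff[THEN iffD2])
    moreover have "continuous_on (cball 0 1) g" using g by (simp add: disc_alg_def)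
    ultimately have "(\<lambda>n. g (s (r n))) \<longlonglongrightarrow> g q"
      using q1 s(1) continuous_on_tendsto_compose[of "cball 0 1" g "\<lambda>n. s (r n)" q sequentially] by (simp add: always_eventually)
    then have lim0: "(\<lambda>n. cmod (g (s (r n))) + supnorm (\<lambda>z. x (r n) z - g z)) \<longlonglongrightarrow> 0"
      using tendsto_add[OF tendsto_norm lim] gq by fastforce
    \<comment> \<open>The function has modulus at least 1/2 at \<open>s (r n)\<close> before it is
      divided by its norm, which is at most 2.\<close>
    have "1/4 \<le> cmod (g (s (r n))) + supnorm (\<lambda>z. x (r n) z - g z)" for n
    proof -
      have "1/2 * (1/2) \<le> inverse (N (r n)) * cmod (f (r n) (s (r n)))"
        using s(3) N2[of "r n"] Npos[of "r n"] by (intro mult_mono) (auto simp: field_simps)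
      also have "\<dots> = cmod (x (r n) (s (r n)))"
        using Npos[of "r n"] by (simp add: x_def norm_mult norm_inverse)
      also have "\<dots> \<le> cmod (g (s (r n))) + cmod (x (r n) (s (r n)) - g (s (r n)))"
        by (rule norm_triangle_sub)
      also have "cmod (x (r n) (s (r n)) - g (s (r n))) \<le> supnorm (\<lambda>z. x (r n) z - g z)"
        using s(1)[of "r n"] by (intro norm_le_supnorm[where h = "\<lambda>z. x (r n) z - g z"] disc_alg_intros x g) auto
      finally show ?thesis by simp
    qed
    with LIMSEQ_le_const[OF lim0, of "1/4"] show False by auto
  qed
  then show ?thesis
    unfolding usf_spectrum_def using x x1 lim by blast
qed

text \<open>The largest modulus is realised at the fixed point \<open>p\<close>, each smaller one on
  a cycle of its own. The weight vanishes at the preimages of these cycles outside them, which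
  separates the cycles from the rest of the circle.\<close>

theorem usf_spectrum_prescribed:
  fixes lam :: "nat \<Rightarrow> complex" and m :: nat
  assumes m: "m \<ge> 1" and lam: "\<And>j. 1 \<le> j \<Longrightarrow> j < m \<Longrightarrow> cmod (lam j) < cmod (lam (Suc j))"
  shows "\<exists>w\<in>disc_alg. usf_spectrum (\<lambda>f z. w z * f (B z)) = (\<Union>j\<in>{1..m}. (\<lambda>t. lam j * t) ` sphere 0 1)"
proof -
  have lam_less: "cmod (lam j) < cmod (lam m)" if "1 \<le> j" "j < m" for j
  proof -
    have "Suc j \<le> k \<Longrightarrow> k \<le> m \<Longrightarrow> cmod (lam j) < cmod (lam k)" for k
    proof (induction k rule: dec_induct)
      case base
      then show ?case using lam that by simp
    next
      case (step k)
      then show ?case using lam[of k] that by simp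
    qed
    with that show ?thesis by simp
  qed
  define R where "R = cmod (lam m)"
  obtain p0 where p0: "b p0 = p0" "\<And>t. p0 < t \<Longrightarrow> t < b t" using repelling_fixed_point by blast
  define p where "p = cis p0"
  have p1: "cmod p = 1" by (simp add: p_def)
  have Bp: "B p = p" by (simp add: p_def B_cis p0)
  have per_p: "periodic p" unfolding periodic_def using p1 Bp by (intro conjI exI[of _ 1]) auto
  have orb_p: "orb p = {p}"
  proof -
    have "(B ^^ k) p = p" for k by (induction k) (auto simp: Bp)
    then show ?thesis by (auto simp: orb_def)
  qed
  obtain q :: "nat \<Rightarrow> complex" where q: "\<And>i. periodic (q i)" "\<And>i. p \<notin> orb (q i)"
      "\<And>i j. i \<noteq> j \<Longrightarrow> orb (q i) \<inter> orb (q j) = {}"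
    using disjoint_periodic_orbits[OF Bp] by blast
  define S where "S = (\<Union>j\<in>{1..<m}. orb (q j))"
  have S1: "cmod x = 1" if "x \<in> S" for x using that orb_sphere[OF q(1)] by (auto simp: S_def)
  have BS: "B x \<in> S" if "x \<in> S" for x using that B_orb by (auto simp: S_def)
  define E where "E = S \<union> (\<Union>x\<in>S. {z. cmod z = 1 \<and> B z = x})"
  have finE: "finite E" unfolding E_def S_def using finite_orb[OF q(1)] finite_fibre by auto
  have E1: "E \<subseteq> sphere 0 1" using S1 by (auto simp: E_def)
  have pE: "p \<notin> E" using q(2) Bp by (auto simp: E_def S_def)
  define J where "J x = (SOME j. j \<in> {1..<m} \<and> x \<in> orb (q j))" for x
  have J: "J x = j" if "j \<in> {1..<m}" "x \<in> orb (q j)" for x j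
  proof -
    have "J x \<in> {1..<m} \<and> x \<in> orb (q (J x))" unfolding J_def by (rule someI[of _ j]) (use that in simp)
    with that(2) have "orb (q (J x)) \<inter> orb (q j) \<noteq> {}" by blast
    with q(3) show ?thesis by metis
  qed
  \<comment> \<open>The interpolation needs values below 1, hence the division by \<open>R\<close>,
    undone by the factor \<open>lam m\<close> in \<open>w\<close>. If \<open>R = 0\<close>, then m =
    1 and \<open>S\<close> is empty.\<close>
  define v where "v x = (if x \<in> S then cmod (lam (J x)) / R else 0)" for x
  have v: "0 \<le> v x \<and> v x < 1" for x
  proof (cases "x \<in> S")
    case True
    then obtain j where j: "j \<in> {1..<m}" "x \<in> orb (q j)" by (auto simp: S_def)
    have "cmod (lam j) < R" using lam_less[of j] j by (simp add: R_def)
    moreover from this have "0 < R" by (rule le_less_trans[OF norm_ge_zero])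
    ultimately show ?thesis using True J[OF j] by (simp add: v_def)
  qed (simp add: v_def)
  obtain w0 where w0: "w0 \<in> disc_alg" "\<And>z. cmod z = 1 \<Longrightarrow> cmod (w0 z) \<le> 1" "cmod (w0 p) = 1"
    "\<And>x. x \<in> E \<Longrightarrow> cmod (w0 x) = v x" "\<And>z. cmod z = 1 \<Longrightarrow> w0 z = 0 \<Longrightarrow> z \<in> E"
    using finite_modulus_interpolation[where v = v, OF p1 finE E1 pE v] by auto
  define w where "w z = lam m * w0 z" for z
  have w: "w \<in> disc_alg" unfolding w_def[abs_def] by (intro disc_alg_intros w0(1))
  have w_orb: "cmod (w x) = cmod (lam j)" if "j \<in> {1..<m}" "x \<in> orb (q j)" for x j
  proof -
    have xS: "x \<in> S" using that by (auto simp: S_def)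
    then have "cmod (w0 x) = v x" by (intro w0(4)) (simp add: E_def)
    moreover have "R > 0" using lam_less[of j] that by (auto simp: R_def intro: le_less_trans[OF norm_ge_zero])
    ultimately show ?thesis using J[OF that] xS by (simp add: w_def norm_mult v_def R_def)
  qed
  have w_le: "cmod (w z) \<le> R" if "cmod z = 1" for z
    using mult_left_mono[OF w0(2)[OF that] norm_ge_zero[of "lam m"]] by (simp add: w_def norm_mult R_def)
  have w_p: "cmod (w p) = R" by (simp add: w_def norm_mult w0 R_def)
  have w_zero: "w z = 0" if "cmod z = 1" "B z \<in> S" "z \<notin> S" for z
  proof -
    have "cmod (w0 z) = v z" using that by (intro w0(4)) (auto simp: E_def)
    then show ?thesis using that by (simp add: w_def v_def)
  qed
  have w_zeroD: "B z \<in> S" if "R > 0" "cmod z = 1" "w z = 0" for z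
  proof -
    have "z \<in> E" using that by (intro w0(5)) (auto simp: w_def R_def)
    then show ?thesis using BS by (auto simp: E_def)
  qed
  \<comment> \<open>A preimage of one cycle cannot lie on another, since the cycles are invariant
    and disjoint.\<close>
  have w_pre: "w y = 0 \<or> y \<in> orb (q j)" if "cmod y = 1" "j \<in> {1..<m}" "B y \<in> orb (q j)" for y j
  proof (cases "y \<in> S")
    case True
    then obtain i where i: "i \<in> {1..<m}" "y \<in> orb (q i)" by (auto simp: S_def)
    then have "i = j" using q(3)[of i j] B_orb[OF i(2)] that by blast
    with i show ?thesis by simp
  next
    case False
    moreover have "B y \<in> S" using that(2,3) unfolding S_def by blast
    ultimately show ?thesis using w_zero[OF that(1)] by blast
  qed
  have "usf_spectrum (\<lambda>f z. w z * f (B z)) = (\<Union>j\<in>{1..m}. {\<mu>. cmod \<mu> = cmod (lam j)})"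
  proof (intro equalityI subsetI)
    fix \<mu> assume \<mu>: "\<mu> \<in> usf_spectrum (\<lambda>f z. w z * f (B z))"
    have "cmod \<mu> = R \<or> (\<exists>x\<in>S. cmod \<mu> = cmod (w x))"
    proof (rule usf_spectrum_modulus[OF w S1 BS _ _ w_zeroD w_le _ p0 \<mu>])
      show "cmod (w (B x)) = cmod (w x)" if "x \<in> S" for x
        using that w_orb B_orb by (fastforce simp: S_def)
      show "\<exists>y\<in>S. B y = x" if "x \<in> S" for x
        using that orb_predecessor[OF q(1)] unfolding S_def by (metis UN_iff)
      show "cmod (w (cis p0)) = R" using w_p by (simp add: p_def)
    qed
    then show "\<mu> \<in> (\<Union>j\<in>{1..m}. {\<mu>. cmod \<mu> = cmod (lam j)})"
    proof
      assume "cmod \<mu> = R"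
      then show ?thesis using m by (auto simp: R_def)
    next
      assume "\<exists>x\<in>S. cmod \<mu> = cmod (w x)"
      then obtain j x where "j \<in> {1..<m}" "x \<in> orb (q j)" "cmod \<mu> = cmod (w x)" by (auto simp: S_def)
      then show ?thesis using w_orb by (intro UN_I[of j]) auto
    qed
  next
    fix \<mu> assume "\<mu> \<in> (\<Union>j\<in>{1..m}. {\<mu>. cmod \<mu> = cmod (lam j)})"
    then obtain j where j: "1 \<le> j" "j \<le> m" "cmod \<mu> = cmod (lam j)" by auto
    show "\<mu> \<in> usf_spectrum (\<lambda>f z. w z * f (B z))"
    proof (cases "j = m")
      case True
      show ?thesis
      proof (cases "R = 0")
        case True
        then have "w y = 0" if "cmod y = 1" for y using w_le[OF that] by simp
        then have "0 \<in> usf_spectrum (\<lambda>f z. w z * f (B z))" by (intro usf_spectrum_zero[OF w p1])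
        moreover have "\<mu> = 0" using True j \<open>j = m\<close> by (simp add: R_def)
        ultimately show ?thesis by simp
      next
        case False
        then have "R > 0" by (simp add: R_def)
        then show ?thesis
        proof (rule usf_spectrum_periodic[OF w per_p])
          show "cmod \<mu> = R" using j \<open>j = m\<close> by (simp add: R_def)
          show "cmod (w x) = R" if "x \<in> orb p" for x using that w_p by (simp add: orb_p)
          fix k y assume y: "cmod y = 1"
          \<comment> \<open>For \<open>p\<close> the bound along branches holds because |w| \<le> R
            on the whole circle.\<close>
          have "cmod (wprod w k y) \<le> (\<Prod>i<k. R)"
            unfolding wprod_def prod_norm[symmetric] using y by (intro prod_mono conjI w_le iter_sphere) auto
          then show "cmod (wprod w k y) \<le> R ^ k" by simp
        qed
      qed
    next
      case False
      then have jm: "j \<in> {1..<m}" using j by simp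
      show ?thesis
      proof (cases "lam j = 0")
        case True
        \<comment> \<open>\<open>w\<close> vanishes on the whole fibre over \<open>q j\<close>: off
          the cycle by \<open>w_pre\<close>, on it because \<open>lam j = 0\<close>.\<close>
        have "0 \<in> usf_spectrum (\<lambda>f z. w z * f (B z))"
        proof (rule usf_spectrum_zero[OF w])
          show "cmod (q j) = 1" using q(1) by (simp add: periodic_def)
          fix y assume "cmod y = 1" "B y = q j"
          then have "w y = 0 \<or> y \<in> orb (q j)" using jm orb_self by (intro w_pre) auto
          then show "w y = 0" using w_orb[OF jm] True by auto
        qed
        moreover have "\<mu> = 0" using True j by simp
        ultimately show ?thesis by simp
      next
        case False
        then have "cmod (lam j) > 0" by simp
        then show ?thesis
        proof (rule usf_spectrum_periodic[OF w q(1) _ j(3)])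
          show orbw: "cmod (w x) = cmod (lam j)" if "x \<in> orb (q j)" for x using w_orb[OF jm that] .
          \<comment> \<open>A branch that ends on the cycle either starts on it or enters it through
            a zero of \<open>w\<close>.\<close>
          have alt: "cmod y = 1 \<Longrightarrow> (B ^^ k) y \<in> orb (q j) \<Longrightarrow> wprod w k y = 0 \<or> y \<in> orb (q j)" for k y
          proof (induction k arbitrary: y)
            case 0
            then show ?case by simp
          next
            case (Suc k)
            have "(B ^^ k) (B y) \<in> orb (q j)" using Suc.prems(2) by (simp add: funpow_swap1)
            from Suc.IH[OF B_sphere[OF Suc.prems(1)] this] show ?case
              using w_pre[OF Suc.prems(1) jm] by (auto simp: wprod_Suc)
          qed
          fix k y assume y: "cmod y = 1" "(B ^^ k) y \<in> orb (q j)"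
          from alt[OF this] show "cmod (wprod w k y) \<le> cmod (lam j) ^ k"
          proof
            assume yo: "y \<in> orb (q j)"
            have "cmod (w ((B ^^ i) y)) = cmod (lam j)" for i
              using orb_trans[OF yo] by (intro orbw) (auto simp: orb_def)
            then show ?thesis by (simp add: wprod_def prod_norm[symmetric])
          qed simp
        qed
      qed
    qed
  qed
  then show ?thesis using w unfolding circle_image by blast
qed

end

subsection \<open>Blaschke products\<close>

lemma one_minus_cnj_mult_Re_pos:
  assumes "cmod a < 1" "cmod z \<le> 1"
  shows "Re (1 - cnj a * z) > 0"
proof -
  have "Re (cnj a * z) \<le> cmod (cnj a * z)" by (rule complex_Re_le_cmod)
  also have "\<dots> \<le> cmod a * 1" unfolding norm_mult using assms by (intro mult_mono) auto
  finally show ?thesis using assms by simp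
qed

lemma one_minus_cnj_mult_nonzero:
  assumes "cmod a < 1" "cmod z \<le> 1"
  shows "1 - cnj a * z \<noteq> 0"
  using one_minus_cnj_mult_Re_pos[OF assms] by (metis less_irrefl zero_complex.sel(1))

text \<open>On the circle z - a = z * cnj u with u = 1 - cnj a * z, so the Moebius factor is z * cnj
  u / u, of angle t - 2 Arg u. As Re u > 0 for |a| < 1, the principal logarithm gives a smooth
  choice of that angle.\<close>

definition moebius_lift :: "complex \<Rightarrow> real \<Rightarrow> real" where
  "moebius_lift a t = t - 2 * Im (Ln (1 - cnj a * cis t))"

lemma moebius_lift:
  assumes "cmod a < 1"
  shows "(cis t - a) / (1 - cnj a * cis t) = cis (moebius_lift a t)"
proof -
  define u where "u = 1 - cnj a * cis t"
  have u: "u \<noteq> 0" unfolding u_def using assms by (intro one_minus_cnj_mult_nonzero) auto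
  have "cis t * cnj (cis t) = 1" by (simp add: cis_cnj cis_mult)
  then have "cis t - a = cis t * cnj u" by (simp add: u_def algebra_simps)
  moreover have "cnj u = u * cis (- 2 * Im (Ln u))"
  proof -
    have "cnj u = exp (cnj (Ln u))" using u by (simp flip: exp_cnj)
    also have "cnj (Ln u) = Ln u + \<i> * of_real (- 2 * Im (Ln u))" by (simp add: complex_eq_iff)
    also have "exp \<dots> = u * cis (- 2 * Im (Ln u))" unfolding exp_add cis_conv_exp using u by simp
    finally show ?thesis .
  qed
  ultimately have "(cis t - a) / u = cis t * cis (- 2 * Im (Ln u))" using u by simp
  then show ?thesis by (simp add: u_def moebius_lift_def cis_mult)
qed

lemma moebius_lift_period: "moebius_lift a (t + 2 * pi) = moebius_lift a t + 2 * pi"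
proof -
  have "cis (t + 2 * pi) = cis t" by (simp add: complex_eq_iff)
  then show ?thesis by (simp add: moebius_lift_def)
qed

text \<open>The derivative is the Poisson kernel (1 - |a|^2) / |u|^2.\<close>

lemma moebius_lift_deriv:
  assumes "cmod a < 1"
  shows "\<exists>y>0. (moebius_lift a has_real_derivative y) (at t)"
proof -
  define u where "u = 1 - cnj a * cis t"
  have Re: "Re u > 0" unfolding u_def using assms by (intro one_minus_cnj_mult_Re_pos) auto
  then have u: "u \<noteq> 0" "u \<notin> \<real>\<^sub>\<le>\<^sub>0" by (auto simp: complex_nonpos_Reals_iff)
  have "(cis has_vector_derivative \<i> * cis t) (at t)"
    unfolding has_vector_derivative_complex_iff
    by (auto intro!: derivative_eq_intros simp: complex_eq_iff)
  then have "((\<lambda>t. 1 - cnj a * cis t) has_vector_derivative - (cnj a * (\<i> * cis t))) (at t)"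
    by (auto intro!: derivative_eq_intros)
  moreover have "(Ln has_field_derivative inverse u) (at u)" using u by (intro has_field_derivative_Ln)
  ultimately have "((Ln \<circ> (\<lambda>t. 1 - cnj a * cis t)) has_vector_derivative - (cnj a * (\<i> * cis t)) * inverse u) (at t)"
    unfolding u_def by (intro field_vector_diff_chain_at)
  then have D0: "((\<lambda>t. Im (Ln (1 - cnj a * cis t))) has_real_derivative Im (- (cnj a * (\<i> * cis t)) * inverse u)) (at t)"
    using bounded_linear.has_vector_derivative[OF bounded_linear_Im]
    by (fastforce simp: o_def has_real_derivative_iff_has_vector_derivative)
  have D: "(moebius_lift a has_real_derivative 1 - 2 * Im (- (cnj a * (\<i> * cis t)) * inverse u)) (at t)"
    unfolding moebius_lift_def[abs_def] by (rule DERIV_diff[OF DERIV_ident DERIV_cmult[OF D0, of 2]])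
  have "- (cnj a * (\<i> * cis t)) * inverse u = \<i> * (1 - inverse u)"
    using u by (simp add: u_def field_simps)
  then have "1 - 2 * Im (- (cnj a * (\<i> * cis t)) * inverse u) = 2 * Re (inverse u) - 1" by simp
  also have "\<dots> = (2 * Re u - (cmod u)\<^sup>2) / (cmod u)\<^sup>2"
    using Re by (simp add: inverse_complex.simps cmod_power2 diff_divide_distrib)
  also have "2 * Re u - (cmod u)\<^sup>2 = 1 - (cmod a)\<^sup>2"
  proof -
    have "2 * Re u - (cmod u)\<^sup>2 = 1 - (cmod (1 - u))\<^sup>2" by (simp add: cmod_power2) algebra
    also have "cmod (1 - u) = cmod a" by (simp add: u_def norm_mult)
    finally show ?thesis .
  qed
  finally have "1 - 2 * Im (- (cnj a * (\<i> * cis t)) * inverse u) = (1 - (cmod a)\<^sup>2) / (cmod u)\<^sup>2" .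
  moreover have "(1 - (cmod a)\<^sup>2) / (cmod u)\<^sup>2 > 0"
    using u assms by (intro divide_pos_pos) (auto simp: power_less_one_iff abs_square_less_1)
  ultimately show ?thesis using D by metis
qed

lemma blaschke_circle_covering:
  assumes a: "valid_blaschke a d" and d: "d \<ge> 2"
  shows "circle_covering (blaschke \<theta> a d) (\<lambda>t. \<theta> + (\<Sum>j<d. moebius_lift (a j) t)) d"
proof
  let ?B = "blaschke \<theta> a d" and ?b = "\<lambda>t. \<theta> + (\<Sum>j<d. moebius_lift (a j) t)"
  have a1: "cmod (a j) < 1" if "j < d" for j using a that by (simp add: valid_blaschke_def)
  have nz: "1 - cnj (a j) * z \<noteq> 0" if "j < d" "cmod z \<le> 1" for j z
    using a1[OF that(1)] that(2) by (rule one_minus_cnj_mult_nonzero)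
  have deriv: "\<exists>y>0. (?b has_real_derivative y) (at t)" for t
  proof -
    have "\<forall>j. \<exists>y. j < d \<longrightarrow> y > 0 \<and> (moebius_lift (a j) has_real_derivative y) (at t)"
      using moebius_lift_deriv[OF a1] by blast
    then obtain y where y: "\<And>j. j < d \<Longrightarrow> y j > 0 \<and> (moebius_lift (a j) has_real_derivative y j) (at t)"
      by metis
    then have "(?b has_real_derivative (\<Sum>j<d. y j)) (at t)" by (auto intro!: derivative_eq_intros)
    moreover have "(\<Sum>j<d. y j) > 0" using y d by (intro sum_pos) (auto simp: lessThan_empty_iff)
    ultimately show ?thesis by blast
  qed
  show "d \<ge> 2" by (rule d)
  show "?B \<in> disc_alg"
    unfolding disc_alg_def blaschke_def using nz by (auto intro!: continuous_intros holomorphic_intros)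
  show "?B ` ball 0 1 \<subseteq> ball 0 1"
  proof safe
    fix z :: complex assume z: "z \<in> ball 0 1"
    have f: "cmod ((z - a j) / (1 - cnj (a j) * z)) < 1" if "j < d" for j
      using Moebius_function_norm_lt_1[OF a1[OF that], of z 0] z by (simp add: Moebius_function_def)
    \<comment> \<open>One factor is split off to give the strict inequality; for the product of the
      others a bound by 1 suffices.\<close>
    obtain d' where d': "d = Suc d'" using d by (cases d) auto
    have "cmod (\<Prod>j<d'. (z - a j) / (1 - cnj (a j) * z)) \<le> 1"
      unfolding prod_norm[symmetric] using f by (intro prod_le_1) (auto simp: d' less_imp_le)
    then have "cmod (\<Prod>j<d'. (z - a j) / (1 - cnj (a j) * z)) * cmod ((z - a d') / (1 - cnj (a d') * z)) \<le> cmod ((z - a d') / (1 - cnj (a d') * z))"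
      by (intro mult_left_le_one_le) auto
    also have "\<dots> < 1" using f by (simp add: d')
    finally have "cmod ((\<Prod>j<d'. (z - a j) / (1 - cnj (a j) * z)) * ((z - a d') / (1 - cnj (a d') * z))) < 1"
      by (simp only: norm_mult)
    then have "cmod (?B z) < 1"
      unfolding blaschke_def d' prod.lessThan_Suc by (subst norm_mult) simp
    then show "?B z \<in> ball 0 1" by simp
  qed
  show Bcis: "?B (cis t) = cis (?b t)" for t
  proof -
    have "(\<Prod>j<n. cis (x j)) = cis (\<Sum>j<n. x j)" for n and x :: "nat \<Rightarrow> real"
      by (induction n) (auto simp: cis_mult)
    then show ?thesis using moebius_lift[OF a1] by (simp add: blaschke_def cis_conv_exp[symmetric] cis_mult)
  qed
  show "continuous_on UNIV ?b"
    using deriv by (meson DERIV_isCont continuous_at_imp_continuous_on)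
  show "strict_mono ?b"
  proof (rule strict_monoI)
    fix s t :: real assume "s < t"
    then show "?b s < ?b t" by (rule DERIV_pos_imp_increasing) (metis deriv)
  qed
  show "?b (t + 2 * pi) = ?b t + 2 * pi * real d" for t
    by (simp add: moebius_lift_period sum.distrib)
  have iter1: "cmod ((?B ^^ k) z) = 1" if "cmod z = 1" for k z
  proof (induction k)
    case (Suc k)
    then obtain t where "(?B ^^ k) z = cis t" using unit_circle_cis by blast
    then show ?case by (simp add: Bcis)
  qed (simp add: that)
  show "\<exists>P Q. \<forall>z. cmod z = 1 \<longrightarrow> poly Q z \<noteq> 0 \<and> (?B ^^ k) z = poly P z / poly Q z" for k
  proof (induction k)
    case 0
    show ?case by (intro exI[of _ "[:0, 1:]"] exI[of _ 1]) simp
  next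
    case (Suc k)
    then obtain P Q where PQ: "\<And>z. cmod z = 1 \<Longrightarrow> poly Q z \<noteq> 0" "\<And>z. cmod z = 1 \<Longrightarrow> (?B ^^ k) z = poly P z / poly Q z"
      by blast
    \<comment> \<open>\<open>B\<close> applied to \<open>P / Q\<close>, with every Moebius factor
      expanded by \<open>Q\<close>; numerator and denominator have equally many factors, so the
      powers of \<open>Q\<close> cancel.\<close>
    let ?P = "smult (exp (\<i> * of_real \<theta>)) (\<Prod>j<d. P - smult (a j) Q)" and ?Q = "\<Prod>j<d. Q - smult (cnj (a j)) P"
    have "poly ?Q z \<noteq> 0 \<and> (?B ^^ Suc k) z = poly ?P z / poly ?Q z" if z: "cmod z = 1" for z
    proof -
      define y where "y = (?B ^^ k) z"
      have Py: "poly P z = y * poly Q z" using PQ[OF z] by (simp add: y_def)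
      have y1: "cmod y \<le> 1" using iter1[OF z] by (simp add: y_def)
      have Qf: "poly (Q - smult (cnj (a j)) P) z = poly Q z * (1 - cnj (a j) * y)" for j
        by (simp add: Py algebra_simps)
      have Pf: "poly (P - smult (a j) Q) z = poly Q z * (y - a j)" for j
        by (simp add: Py algebra_simps)
      have "poly ?Q z \<noteq> 0" unfolding poly_prod Qf using nz[OF _ y1] PQ(1)[OF z] by simp
      moreover have "(?B ^^ Suc k) z = poly ?P z / poly ?Q z"
      proof -
        have "poly ?P z / poly ?Q z = exp (\<i> * of_real \<theta>)
            * (\<Prod>j<d. (poly Q z * (y - a j)) / (poly Q z * (1 - cnj (a j) * y)))"
          unfolding poly_smult poly_prod Pf Qf prod_dividef by simp
        also have "\<dots> = ?B y" using PQ(1)[OF z] by (simp add: blaschke_def)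
        finally show ?thesis by (simp add: y_def)
      qed
      ultimately show ?thesis by blast
    qed
    then show ?case by blast
  qed
qed

theorem theorem8:
  fixes \<theta> :: real and a :: "nat \<Rightarrow> complex" and d :: nat
    and lam :: "nat \<Rightarrow> complex" and m :: nat
  assumes "valid_blaschke a d" and "d \<ge> 2"
    and "elliptic (blaschke \<theta> a d) \<or> doubly_parabolic (blaschke \<theta> a d)"
    and "m \<ge> 1"
    and "\<forall>j. 1 \<le> j \<and> j < m \<longrightarrow> cmod (lam j) < cmod (lam (Suc j))"
  shows "\<exists>w \<in> disc_alg.
           usf_spectrum (\<lambda>f z. w z * f (blaschke \<theta> a d z))
             = (\<Union>j\<in>{1..m}. (\<lambda>t. lam j * t) ` sphere 0 1)"
  using circle_covering.usf_spectrum_prescribed[OF blaschke_circle_covering] assms by blast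

end
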